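(* Consider the episodic MDP and the Thompson sampling agent $\pi_{\rm TS}$ described in the context, and assume the optimism hypothesis: for every episode $\ell$ and every time $t\in\{\ell\tau,\ldots,(\ell+1)\tau-1\}$, $\mathbb{E}[V_{\tau,\rho}(S_t)\,|\,P_{\ell\tau}]\le\mathbb{E}[\hat{V}_\ell(S_t)\,|\,P_{\ell\tau}]$. Then for every integer $m\ge2$, with $\delta=1/m$, $$\mathrm{Regret}(T | \pi_{\rm TS}) \leq \tau^2 \sqrt{ 6 |\mathcal{S}| |\mathcal{A}| T \log \frac{1}{\delta} \log \frac{2 |\mathcal{S}| |\mathcal{A}|}{\delta}} + \left[3 \delta + \sqrt{ 6 \max \left \{ 3, \log \frac{1}{\delta}\right \} \delta \log \frac{2 |\mathcal{S}| |\mathcal{A}|}{\delta}} \right] \tau^2 T,$$ which is $O\!\left(\tau^2 \sqrt{\log \frac{1}{\delta} \log \frac{|\mathcal{S}| |\mathcal{A}|}{\delta}} \left[\sqrt{|\mathcal{S}| |\mathcal{A}| T } + T \sqrt{\delta} \right]\right)$.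
   Context: Fix integers $M\ge1$, $\tau\ge2$ and a finite action set $\mathcal{A}$. States: $\mathcal{S}=\{0,\ldots,M-1\}\times\{0,\ldots,\tau-1\}$, $\mathcal{S}_k=\{(m,k):0\le m\le M-1\}$, $|\mathcal{S}|=M\tau$. For $s=(m,k)$ write $s+1=(m+1 \bmod M,\,k+1\bmod\tau)$ and $s-1=(m-1\bmod M,\,k+1\bmod\tau)$. The unknown environment is given by numbers $\rho(s+1|s,a)\in[0,1]$ for $s\notin\mathcal{S}_{\tau-1}$, $a\in\mathcal{A}$, a priori independent and uniform on $[0,1]$: from $s\notin\mathcal{S}_{\tau-1}$ under action $a$ the next state is $s+1$ w.p. $\rho(s+1|s,a)$ and $s-1$ w.p. $1-\rho(s+1|s,a)$; from any state in $\mathcal{S}_{\tau-1}$ the next state is a fixed distinguished initial state $S_0\in\mathcal{S}_0$. The observation at each time is the state $S_t$; the process starts at $S_0$, so episode $\ell$ occupies times $\ell\tau,\ldots,(\ell+1)\tau-1$. A known reward function $r(s,a,s')\in[0,1]$ gives reward $r(S_t,A_t,S_{t+1})$. $Q_{\tau,\rho}$ is the unique solution of $Q_{\tau,\rho}(s,a)=\sum_{s'}\rho(s'|s,a)(r(s,a,s')+\max_{a'}Q_{\tau,\rho}(s',a'))$ for $s\notin\mathcal{S}_{\tau-1}$ and $Q_{\tau,\rho}(s,a)=r(s,a,S_0)$ for $s\in\mathcal{S}_{\tau-1}$; $V_{\tau,\rho}(s)=\max_aQ_{\tau,\rho}(s,a)$. The epistemic state is the posterior $P_t=\mathbb{P}(\rho\in\cdot\,|\,H_t)$,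 $H_t$ the history. Thompson sampling $\pi_{\rm TS}$: at the start of episode $\ell$ sample $\hat\rho_\ell$ from $P_{\ell\tau}$ independently, set $\hat{Q}_\ell=Q_{\tau,\hat\rho_\ell}$, $\hat V_\ell(s)=\max_a\hat Q_\ell(s,a)$, and during episode $\ell$ select actions from a policy supported on $\arg\max_a\hat{Q}_\ell(S_t,a)$. $\mathrm{Regret}(T|\pi)=\mathbb{E}[\sum_{t=0}^{T-1}(V_{\tau,\rho}(S_t)-Q_{\tau,\rho}(S_t,A_t))]$ for the states and actions generated by $\pi$ (the expected shortfall relative to an optimal policy). *)

theory Defs
  imports "HOL-Probability.Probability" "HOL-Probability.Conditional_Expectation"
begin

definition nxt_up :: "nat \<Rightarrow> nat \<Rightarrow> nat \<times> nat \<Rightarrow> nat \<times> nat" where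
  "nxt_up M \<tau> s = (Suc (fst s) mod M, Suc (snd s) mod \<tau>)"

definition nxt_down :: "nat \<Rightarrow> nat \<Rightarrow> nat \<times> nat \<Rightarrow> nat \<times> nat" where
  "nxt_down M \<tau> s = ((fst s + M - 1) mod M, Suc (snd s) mod \<tau>)"

definition states :: "nat \<Rightarrow> nat \<Rightarrow> (nat \<times> nat) set" where
  "states M \<tau> = {0..<M} \<times> {0..<\<tau>}"

text \<open>Index set of the unknown parameters rho(s+1|s,a), s not in the last layer.
  A parameter vector is an element of the product space over this index set;
  rho (s,a) stands for rho(s+1|s,a).\<close>

definition paramidx :: "nat \<Rightarrow> nat \<Rightarrow> ((nat \<times> nat) \<times> 'a) set" where
  "paramidx M \<tau> = {((m,k),a). m < M \<and> k < \<tau> - 1}"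

definition Theta :: "nat \<Rightarrow> nat \<Rightarrow> ((nat \<times> nat) \<times> 'a \<Rightarrow> real) measure" where
  "Theta M \<tau> = PiM (paramidx M \<tau>) (\<lambda>_. borel)"

definition transP :: "nat \<Rightarrow> nat \<Rightarrow> nat \<times> nat \<Rightarrow> ((nat \<times> nat) \<times> 'a \<Rightarrow> real)
    \<Rightarrow> nat \<times> nat \<Rightarrow> 'a \<Rightarrow> nat \<times> nat \<Rightarrow> real" where
  "transP M \<tau> s0 \<rho> s a s' =
     (if snd s = \<tau> - 1 then (if s' = s0 then 1 else 0)
      else (if s' = nxt_up M \<tau> s then \<rho> (s,a) else 0)
         + (if s' = nxt_down M \<tau> s then 1 - \<rho> (s,a) else 0))"

text \<open>Q-values by backward induction: Qsteps j s a is the Q-value of a state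
  with j steps remaining before the last layer.\<close>

fun Qsteps :: "nat \<Rightarrow> nat \<Rightarrow> nat \<times> nat \<Rightarrow> (nat \<times> nat \<Rightarrow> 'a::finite \<Rightarrow> nat \<times> nat \<Rightarrow> real)
    \<Rightarrow> ((nat \<times> nat) \<times> 'a \<Rightarrow> real) \<Rightarrow> nat \<Rightarrow> nat \<times> nat \<Rightarrow> 'a \<Rightarrow> real" where
  "Qsteps M \<tau> s0 r \<rho> 0 s a = r s a s0"
| "Qsteps M \<tau> s0 r \<rho> (Suc j) s a =
     \<rho> (s,a) * (r s a (nxt_up M \<tau> s) + Max (range (Qsteps M \<tau> s0 r \<rho> j (nxt_up M \<tau> s))))
   + (1 - \<rho> (s,a)) * (r s a (nxt_down M \<tau> s) + Max (range (Qsteps M \<tau> s0 r \<rho> j (nxt_down M \<tau> s))))"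

definition Qfun :: "nat \<Rightarrow> nat \<Rightarrow> nat \<times> nat \<Rightarrow> (nat \<times> nat \<Rightarrow> 'a::finite \<Rightarrow> nat \<times> nat \<Rightarrow> real)
    \<Rightarrow> ((nat \<times> nat) \<times> 'a \<Rightarrow> real) \<Rightarrow> nat \<times> nat \<Rightarrow> 'a \<Rightarrow> real" where
  "Qfun M \<tau> s0 r \<rho> s a = Qsteps M \<tau> s0 r \<rho> (\<tau> - 1 - snd s) s a"

definition Vfun :: "nat \<Rightarrow> nat \<Rightarrow> nat \<times> nat \<Rightarrow> (nat \<times> nat \<Rightarrow> 'a::finite \<Rightarrow> nat \<times> nat \<Rightarrow> real)
    \<Rightarrow> ((nat \<times> nat) \<times> 'a \<Rightarrow> real) \<Rightarrow> nat \<times> nat \<Rightarrow> real" where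
  "Vfun M \<tau> s0 r \<rho> s = Max (range (Qfun M \<tau> s0 r \<rho> s))"

definition histS :: "(nat \<Rightarrow> 'w \<Rightarrow> nat \<times> nat) \<Rightarrow> nat \<Rightarrow> 'w \<Rightarrow> (nat \<times> nat) list" where
  "histS S t \<omega> = map (\<lambda>i. S i \<omega>) [0..<Suc t]"

definition histA :: "(nat \<Rightarrow> 'w \<Rightarrow> 'a) \<Rightarrow> nat \<Rightarrow> 'w \<Rightarrow> 'a list" where
  "histA A n \<omega> = map (\<lambda>i. A i \<omega>) [0..<n]"

definition hist :: "(nat \<Rightarrow> 'w \<Rightarrow> nat \<times> nat) \<Rightarrow> (nat \<Rightarrow> 'w \<Rightarrow> 'a) \<Rightarrow> nat
    \<Rightarrow> 'w \<Rightarrow> (nat \<times> nat) list \<times> 'a list" where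
  "hist S A t \<omega> = (histS S t \<omega>, histA A t \<omega>)"

definition HistAlg :: "'w measure \<Rightarrow> (nat \<Rightarrow> 'w \<Rightarrow> nat \<times> nat) \<Rightarrow> (nat \<Rightarrow> 'w \<Rightarrow> 'a::countable)
    \<Rightarrow> nat \<Rightarrow> 'w measure" where
  "HistAlg Pr S A t = vimage_algebra (space Pr) (hist S A t) (count_space UNIV)"

definition samples :: "(nat \<Rightarrow> 'w \<Rightarrow> 'p) \<Rightarrow> nat \<Rightarrow> 'w \<Rightarrow> nat \<Rightarrow> 'p" where
  "samples rh L \<omega> = (\<lambda>l\<in>{..<L}. rh l \<omega>)"

definition FullAlg :: "'w measure \<Rightarrow> nat \<Rightarrow> nat \<Rightarrow> ('w \<Rightarrow> (nat \<times> nat) \<times> 'a::countable \<Rightarrow> real)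
    \<Rightarrow> ('w \<Rightarrow> (nat \<times> nat) list \<times> 'a list) \<Rightarrow> (nat \<Rightarrow> 'w \<Rightarrow> (nat \<times> nat) \<times> 'a \<Rightarrow> real) \<Rightarrow> nat
    \<Rightarrow> 'w measure" where
  "FullAlg Pr M \<tau> rho h rh L = vimage_algebra (space Pr) (\<lambda>\<omega>. (rho \<omega>, h \<omega>, samples rh L \<omega>))
     (Theta M \<tau> \<Otimes>\<^sub>M count_space UNIV \<Otimes>\<^sub>M PiM {..<L} (\<lambda>_. Theta M \<tau>))"

definition AgentAlg :: "'w measure \<Rightarrow> nat \<Rightarrow> nat
    \<Rightarrow> ('w \<Rightarrow> (nat \<times> nat) list \<times> 'a::countable list) \<Rightarrow> (nat \<Rightarrow> 'w \<Rightarrow> (nat \<times> nat) \<times> 'a \<Rightarrow> real) \<Rightarrow> nat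
    \<Rightarrow> 'w measure" where
  "AgentAlg Pr M \<tau> h rh L = vimage_algebra (space Pr) (\<lambda>\<omega>. (h \<omega>, samples rh L \<omega>))
     (count_space UNIV \<Otimes>\<^sub>M PiM {..<L} (\<lambda>_. Theta M \<tau>))"

end

theory Submission
  imports Defs "HOL-Probability.Hoeffding"
begin

text \<open>By optimism and greediness, the expected regret at a time \<open>t\<close> is at most the expectation of
  \<open>Qhat - Q\<close> at \<open>(S\<^sub>t, A\<^sub>t)\<close>. Unrolling this gap along the true dynamics until the end of the episode bounds
  it by the sum of the parameter errors \<open>\<bar>rhohat - rho\<bar>\<close> at the pairs still to be visited, weighted by the
  remaining horizon; over an episode every error gets weight at most \<open>9/16 \<tau>\<^sup>2\<close>.

  The posterior is never computed. Given the parameter, the visits of a pair are Bernoulli trials, so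
  Hoeffding's exponential supermartingale and a union bound over pairs and visit counts put the
  parameter, up to probability \<open>1/m\<close>, into a confidence set that is a function of the history. As \<open>rho\<close> and
  \<open>rhohat\<close> have the same conditional law given the history, \<open>rhohat\<close> lies in this set with the same
  probability. A pair is visited at most once per episode, so the radii, of order \<open>1 / sqrt n\<close> at the
  \<open>n\<close>-th visit, sum to order \<open>sqrt T\<close>.\<close>

section \<open>Values and measurability\<close>

text \<open>Two time scales have to be reconciled. \<open>rho\<close> and \<open>rhohat l\<close>
  share a conditional law given the history at the episode start \<open>l * \<tau>\<close>, so the
  confidence set is built from counts frozen there; the radii, however, sum to order sqrt T along
  running counts. The layer coordinate of a state is a clock modulo \<open>\<tau>\<close>, so no
  state recurs within an episode and both counts agree at the visited pair.

  Conditional expectations are used only as integral identities against bounded weights. Since there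
  are countably many histories, a history-dependent confidence set is treated one history at a time.

  The number of visits is random. Instead of stopping times, the process
  \<open>exp (l * (U - N * rho) - l^2 / 8 * N)\<close> carries the count \<open>N\<close> in its
  exponent: its expectation is at most 1 at every fixed time, and intersecting with the event that
  \<open>N\<close> equals \<open>n\<close> gives the usual Chernoff bound.

  The weight 9/16 is (3/4)^2: \<open>(j + 1) * (\<tau> - j)\<close> is at most ((\<tau> + 1) / 2)^2,
  and \<tau> + 1 \<le> 3/2 \<tau>. Its distance from 1, together with ln m \<ge> 2, pays for
  rounding, for first visits and for the factor 2 in the sum of 1 / sqrt n.\<close>

lemma bernoulli_mgf_le:
  fixes p l :: real
  assumes "0 \<le> p" "p \<le> 1"
  shows "exp (- (l * p)) * (1 - p) + exp (l * (1 - p)) * p \<le> exp (l\<^sup>2 / 8)"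
proof -
  \<comment> \<open>Nonnegative \<open>l\<close> suffices: exchanging the two outcomes, that is
    \<open>l\<close> with \<open>- l\<close> and \<open>p\<close> with \<open>1 - p\<close>, leaves
    the left-hand side and \<open>l^2\<close> unchanged.\<close>
  have pos_case: "exp (- (l * p)) * (1 - p) + exp (l * (1 - p)) * p \<le> exp (l\<^sup>2 / 8)"
    if "0 \<le> l" "0 \<le> p" "p \<le> 1" for l p :: real
  proof -
    have pos: "1 + p * (exp l - 1) > 0"
      using that by (smt (verit) mult_nonneg_nonneg one_le_exp_iff)
    have "exp (- (l * p)) * (1 - p) + exp (l * (1 - p)) * p = exp (- l * p) * (1 + p * (exp l - 1))"
      by (simp add: algebra_simps exp_diff exp_minus divide_simps)
    also have "\<dots> = exp (- l * p + ln (1 + p * (exp l - 1)))"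
      using pos by (simp only: exp_add exp_ln)
    also have "\<dots> \<le> exp (l\<^sup>2 / 8)"
      using Hoeffdings_lemma_aux[of l p] that by simp
    finally show ?thesis .
  qed
  show ?thesis
  proof (cases "l \<ge> 0")
    case False
    with pos_case[of "- l" "1 - p"] assms show ?thesis by (simp add: algebra_simps)
  qed (use pos_case assms in auto)
qed

section \<open>Measurability with respect to generated sigma-algebras\<close>

lemma vimage_algebra_measurable:
  assumes "f \<in> measurable N K"
  shows "f \<in> measurable (vimage_algebra (space N) f K) K"
  using assms by (intro measurable_vimage_algebra1) (auto dest: measurable_space)

lemma subalgebra_vimage_algebra:
  assumes "f \<in> measurable N K"
  shows "subalgebra N (vimage_algebra (space N) f K)"
  using assms
  by (auto simp: subalgebra_def sets_vimage_algebra2[OF measurable_space[OF assms, THEN funcsetI]])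

lemma measurable_Pair_countable:
  fixes f :: "'w \<Rightarrow> 'b::countable" and g :: "'w \<Rightarrow> 'c::countable"
  assumes "f \<in> measurable N (count_space UNIV)" "g \<in> measurable N (count_space UNIV)"
  shows "(\<lambda>\<omega>. (f \<omega>, g \<omega>)) \<in> measurable N (count_space UNIV)"
  using measurable_Pair[OF assms] by (simp add: pair_measure_countable)

lemma measurable_history:
  fixes S :: "nat \<Rightarrow> 'w \<Rightarrow> 'b::countable"
  assumes "\<And>i. i < n \<Longrightarrow> S i \<in> measurable N (count_space UNIV)"
  shows "(\<lambda>\<omega>. map (\<lambda>i. S i \<omega>) [0..<n]) \<in> measurable N (count_space UNIV)"
  using assms
proof (induction n)
  case (Suc n)
  have "(\<lambda>\<omega>. (\<lambda>(xs, x). xs @ [x]) (map (\<lambda>i. S i \<omega>) [0..<n], S n \<omega>))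
      \<in> measurable N (count_space UNIV)"
    by (rule measurable_compose[where N = "count_space UNIV"])
      (use Suc in \<open>auto intro!: measurable_Pair_countable\<close>)
  then show ?case by simp
qed simp

lemma measurable_FullAlg_generator:
  fixes rho :: "'w \<Rightarrow> (nat \<times> nat) \<times> 'a::countable \<Rightarrow> real"
  assumes "rho \<in> measurable N (Theta M \<tau>)" "h \<in> measurable N (count_space UNIV)"
    and "\<And>l. rh l \<in> measurable N (Theta M \<tau>)"
  shows "(\<lambda>\<omega>. (rho \<omega>, h \<omega>, samples rh L \<omega>)) \<in> measurable N
     (Theta M \<tau> \<Otimes>\<^sub>M count_space UNIV \<Otimes>\<^sub>M PiM {..<L} (\<lambda>_. Theta M \<tau>))"
  unfolding samples_def using assms by (intro measurable_Pair measurable_restrict)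

lemma
  fixes rho :: "'w \<Rightarrow> (nat \<times> nat) \<times> 'a::countable \<Rightarrow> real"
  assumes "rho \<in> measurable N (Theta M \<tau>)" "h \<in> measurable N (count_space UNIV)"
    and "\<And>l. rh l \<in> measurable N (Theta M \<tau>)"
  shows subalgebra_FullAlg: "subalgebra N (FullAlg N M \<tau> rho h rh L)"
    and measurable_FullAlg_param: "rho \<in> measurable (FullAlg N M \<tau> rho h rh L) (Theta M \<tau>)"
    and measurable_FullAlg_hist: "h \<in> measurable (FullAlg N M \<tau> rho h rh L) (count_space UNIV)"
    and measurable_FullAlg_sample:
      "l < L \<Longrightarrow> rh l \<in> measurable (FullAlg N M \<tau> rho h rh L) (Theta M \<tau>)"
proof -
  note gen = measurable_FullAlg_generator[where L = L, OF assms]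
  show "subalgebra N (FullAlg N M \<tau> rho h rh L)"
    unfolding FullAlg_def by (rule subalgebra_vimage_algebra[OF gen])
  note G = vimage_algebra_measurable[OF gen, folded FullAlg_def]
  show "rho \<in> measurable (FullAlg N M \<tau> rho h rh L) (Theta M \<tau>)"
    using measurable_compose[OF G measurable_fst] by simp
  show "h \<in> measurable (FullAlg N M \<tau> rho h rh L) (count_space UNIV)"
    using measurable_compose[OF measurable_compose[OF G measurable_snd] measurable_fst] by simp
  assume l: "l < L"
  show "rh l \<in> measurable (FullAlg N M \<tau> rho h rh L) (Theta M \<tau>)"
    using measurable_compose[OF measurable_compose[OF measurable_compose[OF G measurable_snd] measurable_snd]
        measurable_component_singleton[of l]] l
    by (simp add: samples_def)
qed

lemma measurable_Theta_component [measurable]: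
  assumes "f \<in> measurable N (Theta M \<tau>)"
  shows "(\<lambda>\<omega>. f \<omega> x) \<in> borel_measurable N"
proof (cases "x \<in> paramidx M \<tau>")
  case True
  with assms show ?thesis
    unfolding Theta_def by (auto intro: measurable_compose[OF _ measurable_component_singleton])
next
  case False
  \<comment> \<open>Functions in the product space are constant outside the index set, so every
    coordinate is measurable and later lemmas can evaluate parameters at arbitrary pairs.\<close>
  have "f \<omega> x = undefined" if "\<omega> \<in> space N" for \<omega>
    using measurable_space[OF assms that] False unfolding Theta_def space_PiM by (rule PiE_arb)
  then show ?thesis by (simp cong: measurable_cong)
qed

lemma measurable_Qsteps:
  fixes r :: "nat \<times> nat \<Rightarrow> 'a::finite \<Rightarrow> nat \<times> nat \<Rightarrow> real"
  assumes f: "f \<in> measurable N (Theta M \<tau>)"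
  shows "(\<lambda>\<omega>. Qsteps M \<tau> s0 r (f \<omega>) j s a) \<in> borel_measurable N"
proof (induction j arbitrary: s a)
  case (Suc j)
  have "(\<lambda>\<omega>. Max (range (Qsteps M \<tau> s0 r (f \<omega>) j s'))) \<in> borel_measurable N" for s'
    by (rule borel_measurable_Max) (use Suc in auto)
  then show ?case
    using f by (auto intro!: borel_measurable_add borel_measurable_times borel_measurable_diff
        measurable_Theta_component)
qed simp

lemma measurable_Qfun:
  fixes r :: "nat \<times> nat \<Rightarrow> 'a::finite \<Rightarrow> nat \<times> nat \<Rightarrow> real"
  assumes "f \<in> measurable N (Theta M \<tau>)" "S \<in> measurable N (count_space UNIV)"
    "A \<in> measurable N (count_space UNIV)"
  shows "(\<lambda>\<omega>. Qfun M \<tau> s0 r (f \<omega>) (S \<omega>) (A \<omega>)) \<in> borel_measurable N"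
proof -
  have "(\<lambda>\<omega>. Qfun M \<tau> s0 r (f \<omega>) s a) \<in> borel_measurable N" for s a
    unfolding Qfun_def using measurable_Qsteps[OF assms(1)] .
  then have "(\<lambda>\<omega>. Qfun M \<tau> s0 r (f \<omega>) (S \<omega>) a) \<in> borel_measurable N" for a
    using assms(2) by (rule measurable_compose_countable)
  then show ?thesis
    using assms(3) by (rule measurable_compose_countable)
qed

lemma measurable_Vfun:
  fixes r :: "nat \<times> nat \<Rightarrow> 'a::finite \<Rightarrow> nat \<times> nat \<Rightarrow> real"
  assumes "f \<in> measurable N (Theta M \<tau>)" "S \<in> measurable N (count_space UNIV)"
  shows "(\<lambda>\<omega>. Vfun M \<tau> s0 r (f \<omega>) (S \<omega>)) \<in> borel_measurable N"
  unfolding Vfun_def by (rule borel_measurable_Max) (auto intro: measurable_Qfun assms)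

section \<open>Bounds and Bellman equation for the values\<close>

text \<open>Valid parameter vectors are probabilities only on the index set; elsewhere they are
  unconstrained, so the value bounds need a state on the grid.\<close>

definition valid_param :: "nat \<Rightarrow> nat \<Rightarrow> ((nat \<times> nat) \<times> 'a \<Rightarrow> real) \<Rightarrow> bool" where
  "valid_param M \<tau> p \<longleftrightarrow> (\<forall>x\<in>paramidx M \<tau>. 0 \<le> p x \<and> p x \<le> 1)"

lemma fst_nxt [simp]:
  assumes "M \<ge> 1"
  shows "fst (nxt_up M \<tau> s) < M" "fst (nxt_down M \<tau> s) < M"
  using assms by (auto simp: nxt_up_def nxt_down_def)

lemma snd_nxt [simp]:
  "snd (nxt_up M \<tau> s) = Suc (snd s) mod \<tau>" "snd (nxt_down M \<tau> s) = Suc (snd s) mod \<tau>"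
  by (auto simp: nxt_up_def nxt_down_def)

lemma paramidx_iff: "(s, a) \<in> paramidx M \<tau> \<longleftrightarrow> fst s < M \<and> snd s < \<tau> - 1"
  by (cases s) (auto simp: paramidx_def)

text \<open>The condition \<open>snd s + j < \<tau>\<close> keeps the recursion inside one episode:
  the \<open>mod\<close> in the successor's layer never wraps, so the parameters met on the way lie
  in the index set. Each step is then a convex combination of one reward plus one value.\<close>

lemma Qsteps_bounds:
  fixes r :: "nat \<times> nat \<Rightarrow> 'a::finite \<Rightarrow> nat \<times> nat \<Rightarrow> real"
  assumes "M \<ge> 1" "\<And>s a s'. 0 \<le> r s a s' \<and> r s a s' \<le> 1" "valid_param M \<tau> p"
    "fst s < M" "snd s + j < \<tau>"
  shows "0 \<le> Qsteps M \<tau> s0 r p j s a \<and> Qsteps M \<tau> s0 r p j s a \<le> real (Suc j)"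
  using assms(4,5)
proof (induction j arbitrary: s a)
  case 0
  then show ?case using assms(2)[of s a s0] by simp
next
  case (Suc j)
  have "(s, a) \<in> paramidx M \<tau>"
    using Suc.prems by (simp add: paramidx_iff)
  then have p: "0 \<le> p (s, a)" "p (s, a) \<le> 1"
    using assms(3) by (auto simp: valid_param_def)
  have V: "0 \<le> r s a s' + Max (range (Qsteps M \<tau> s0 r p j s'))
      \<and> r s a s' + Max (range (Qsteps M \<tau> s0 r p j s')) \<le> real (Suc (Suc j))"
    if "fst s' < M" "snd s' = Suc (snd s) mod \<tau>" for s'
  proof -
    have "snd s' + j < \<tau>" using that Suc.prems by simp
    note IH = Suc.IH[OF that(1) this]
    have "0 \<le> Max (range (Qsteps M \<tau> s0 r p j s'))"
      using IH[of undefined] by (subst Max_ge_iff) auto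
    moreover have "Max (range (Qsteps M \<tau> s0 r p j s')) \<le> real (Suc j)"
      using IH by (subst Max_le_iff) auto
    ultimately show ?thesis
      using assms(2)[of s a s'] by (simp only: of_nat_Suc) linarith
  qed
  let ?u = "r s a (nxt_up M \<tau> s) + Max (range (Qsteps M \<tau> s0 r p j (nxt_up M \<tau> s)))"
  let ?d = "r s a (nxt_down M \<tau> s) + Max (range (Qsteps M \<tau> s0 r p j (nxt_down M \<tau> s)))"
  have u: "0 \<le> ?u" "?u \<le> real (Suc (Suc j))" and d: "0 \<le> ?d" "?d \<le> real (Suc (Suc j))"
    using V[of "nxt_up M \<tau> s"] V[of "nxt_down M \<tau> s"] assms(1) by auto
  have "p (s, a) * ?u + (1 - p (s, a)) * ?d \<le> real (Suc (Suc j))"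
    using u d p by (intro convex_bound_le) auto
  then show ?case
    using u d p by (auto intro!: add_nonneg_nonneg mult_nonneg_nonneg)
qed

lemma Qfun_bounds:
  fixes r :: "nat \<times> nat \<Rightarrow> 'a::finite \<Rightarrow> nat \<times> nat \<Rightarrow> real"
  assumes "M \<ge> 1" "\<And>s a s'. 0 \<le> r s a s' \<and> r s a s' \<le> 1" "valid_param M \<tau> p"
    "fst s < M" "snd s < \<tau>"
  shows "0 \<le> Qfun M \<tau> s0 r p s a" "Qfun M \<tau> s0 r p s a \<le> real (\<tau> - snd s)"
  using Qsteps_bounds[OF assms(1-4), of "\<tau> - 1 - snd s"] assms(5)
  by (auto simp: Qfun_def Suc_diff_Suc)

lemma Qfun_le_Vfun:
  fixes r :: "nat \<times> nat \<Rightarrow> 'a::finite \<Rightarrow> nat \<times> nat \<Rightarrow> real"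
  shows "Qfun M \<tau> s0 r p s a \<le> Vfun M \<tau> s0 r p s"
  by (auto simp: Vfun_def)

lemma Vfun_bounds:
  fixes r :: "nat \<times> nat \<Rightarrow> 'a::finite \<Rightarrow> nat \<times> nat \<Rightarrow> real"
  assumes "M \<ge> 1" "\<And>s a s'. 0 \<le> r s a s' \<and> r s a s' \<le> 1" "valid_param M \<tau> p"
    "fst s < M" "snd s < \<tau>"
  shows "0 \<le> Vfun M \<tau> s0 r p s" "Vfun M \<tau> s0 r p s \<le> real (\<tau> - snd s)"
proof -
  show "0 \<le> Vfun M \<tau> s0 r p s"
    using Qfun_bounds(1)[OF assms] Qfun_le_Vfun by (rule order_trans)
  show "Vfun M \<tau> s0 r p s \<le> real (\<tau> - snd s)"
    unfolding Vfun_def using Qfun_bounds(2)[OF assms] by (subst Max_le_iff) auto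
qed

lemma Qfun_step:
  fixes r :: "nat \<times> nat \<Rightarrow> 'a::finite \<Rightarrow> nat \<times> nat \<Rightarrow> real"
  assumes "snd s < \<tau> - 1"
  shows "Qfun M \<tau> s0 r p s a =
     p (s, a) * (r s a (nxt_up M \<tau> s) + Vfun M \<tau> s0 r p (nxt_up M \<tau> s))
   + (1 - p (s, a)) * (r s a (nxt_down M \<tau> s) + Vfun M \<tau> s0 r p (nxt_down M \<tau> s))"
proof -
  obtain j where j: "\<tau> - 1 - snd s = Suc j"
    using assms by (metis Suc_diff_Suc)
  have "Suc (snd s) mod \<tau> = Suc (snd s)"
    using assms by simp
  moreover have "\<tau> - 1 - Suc (snd s) = j"
    using j by simp
  ultimately show ?thesis
    unfolding Vfun_def Qfun_def j by (simp add: Qfun_def[abs_def])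
qed

lemma Qfun_last:
  fixes r :: "nat \<times> nat \<Rightarrow> 'a::finite \<Rightarrow> nat \<times> nat \<Rightarrow> real"
  assumes "snd s = \<tau> - 1"
  shows "Qfun M \<tau> s0 r p s a = r s a s0"
  using assms by (simp add: Qfun_def)

section \<open>Conditional expectations along the trajectory\<close>

lemma finite_paramidx: "finite (paramidx M \<tau> :: ((nat \<times> nat) \<times> 'a::finite) set)"
  and card_paramidx_le: "card (paramidx M \<tau> :: ((nat \<times> nat) \<times> 'a::finite) set) \<le> M * \<tau> * CARD('a)"
proof -
  have sub: "(paramidx M \<tau> :: ((nat \<times> nat) \<times> 'a) set) \<subseteq> ({..<M} \<times> {..<\<tau>}) \<times> UNIV"
    by (auto simp: paramidx_def)
  show "finite (paramidx M \<tau> :: ((nat \<times> nat) \<times> 'a) set)"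
    using sub by (rule finite_subset) auto
  show "card (paramidx M \<tau> :: ((nat \<times> nat) \<times> 'a) set) \<le> M * \<tau> * CARD('a)"
    using card_mono[OF _ sub] by (simp add: card_cartesian_product)
qed

lemma measurable_transP:
  fixes A :: "'w \<Rightarrow> 'a::countable"
  assumes "f \<in> measurable N (Theta M \<tau>)" "S \<in> measurable N (count_space UNIV)"
    "A \<in> measurable N (count_space UNIV)"
  shows "(\<lambda>\<omega>. transP M \<tau> s0 (f \<omega>) (S \<omega>) (A \<omega>) s') \<in> borel_measurable N"
proof -
  have "(\<lambda>\<omega>. transP M \<tau> s0 (f \<omega>) s a s') \<in> borel_measurable N" for s a
    unfolding transP_def using measurable_Theta_component[OF assms(1)] by auto
  then have "(\<lambda>\<omega>. transP M \<tau> s0 (f \<omega>) (S \<omega>) a s') \<in> borel_measurable N" for a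
    using assms(2) by (rule measurable_compose_countable)
  then show ?thesis
    using assms(3) by (rule measurable_compose_countable)
qed

locale thompson_mdp = prob_space Pr
  for Pr :: "'w measure" +
  fixes M \<tau> :: nat and s0 :: "nat \<times> nat"
    and r :: "nat \<times> nat \<Rightarrow> 'a::finite \<Rightarrow> nat \<times> nat \<Rightarrow> real"
    and rho :: "'w \<Rightarrow> (nat \<times> nat) \<times> 'a \<Rightarrow> real"
    and S :: "nat \<Rightarrow> 'w \<Rightarrow> nat \<times> nat"
    and Act :: "nat \<Rightarrow> 'w \<Rightarrow> 'a"
    and rhohat :: "nat \<Rightarrow> 'w \<Rightarrow> (nat \<times> nat) \<times> 'a \<Rightarrow> real"
    and post :: "nat \<Rightarrow> 'w \<Rightarrow> ((nat \<times> nat) \<times> 'a \<Rightarrow> real) measure"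
  assumes M: "M \<ge> 1" and tau: "\<tau> \<ge> 2"
    and s0: "fst s0 < M" "snd s0 = 0"
    and r: "\<And>s a s'. 0 \<le> r s a s' \<and> r s a s' \<le> 1"
    and meas_rho [measurable]: "rho \<in> measurable Pr (Theta M \<tau>)"
    and meas_S [measurable]: "\<And>t. S t \<in> measurable Pr (count_space UNIV)"
    and meas_A [measurable]: "\<And>t. Act t \<in> measurable Pr (count_space UNIV)"
    and meas_rhohat [measurable]: "\<And>l. rhohat l \<in> measurable Pr (Theta M \<tau>)"
    and prior: "distr Pr (Theta M \<tau>) rho
                  = PiM (paramidx M \<tau>) (\<lambda>_. uniform_measure lborel {0..1::real})"
    and init: "AE \<omega> in Pr. S 0 \<omega> = s0"
    and dyn: "\<And>t s'. AE \<omega> in Pr.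
        real_cond_exp Pr (FullAlg Pr M \<tau> rho (\<lambda>\<omega>. (histS S t \<omega>, histA Act (Suc t) \<omega>)) rhohat (Suc (t div \<tau>)))
                 (\<lambda>\<omega>. indicator {s'} (S (Suc t) \<omega>)) \<omega>
        = transP M \<tau> s0 (rho \<omega>) (S t \<omega>) (Act t \<omega>) s'"
    and post_meas: "\<And>t. post t \<in> measurable (HistAlg Pr S Act t) (prob_algebra (Theta M \<tau>))"
    and post_cond: "\<And>t B. B \<in> sets (Theta M \<tau>) \<Longrightarrow> AE \<omega> in Pr.
        real_cond_exp Pr (HistAlg Pr S Act t) (\<lambda>\<omega>. indicator B (rho \<omega>)) \<omega> = measure (post t \<omega>) B"
    and sampling: "\<And>l B. B \<in> sets (Theta M \<tau>) \<Longrightarrow> AE \<omega> in Pr.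
        real_cond_exp Pr (FullAlg Pr M \<tau> rho (hist S Act (l * \<tau>)) rhohat l)
                 (\<lambda>\<omega>. indicator B (rhohat l \<omega>)) \<omega> = measure (post (l * \<tau>) \<omega>) B"
    and greedy: "\<And>t. AE \<omega> in Pr.
        Qfun M \<tau> s0 r (rhohat (t div \<tau>) \<omega>) (S t \<omega>) (Act t \<omega>)
        = Vfun M \<tau> s0 r (rhohat (t div \<tau>) \<omega>) (S t \<omega>)"
    and optimism: "\<And>l t. l * \<tau> \<le> t \<Longrightarrow> t < (Suc l) * \<tau> \<Longrightarrow> AE \<omega> in Pr.
        real_cond_exp Pr (vimage_algebra (space Pr) (post (l * \<tau>)) (prob_algebra (Theta M \<tau>)))
                 (\<lambda>\<omega>. Vfun M \<tau> s0 r (rho \<omega>) (S t \<omega>)) \<omega>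
        \<le> real_cond_exp Pr (vimage_algebra (space Pr) (post (l * \<tau>)) (prob_algebra (Theta M \<tau>)))
                 (\<lambda>\<omega>. Vfun M \<tau> s0 r (rhohat l \<omega>) (S t \<omega>)) \<omega>"
begin

text \<open>The information just before \<open>S (Suc t)\<close> is drawn. It includes the true
  parameter and the current sample, so that weights depending on them, such as value differences or
  \<open>Z\<close>, may be integrated against the transition.\<close>

abbreviation G :: "nat \<Rightarrow> 'w measure" where
  "G t \<equiv> FullAlg Pr M \<tau> rho (\<lambda>\<omega>. (histS S t \<omega>, histA Act (Suc t) \<omega>)) rhohat (Suc (t div \<tau>))"

lemma measurable_hist: "hist S Act t \<in> measurable Pr (count_space UNIV)"
  unfolding hist_def histS_def histA_def
  by (intro measurable_Pair_countable measurable_history meas_S meas_A)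

lemma measurable_hist_act:
  "(\<lambda>\<omega>. (histS S t \<omega>, histA Act (Suc t) \<omega>)) \<in> measurable Pr (count_space UNIV)"
  unfolding histS_def histA_def
  by (intro measurable_Pair_countable measurable_history meas_S meas_A)

lemmas G_props = meas_rho measurable_hist_act meas_rhohat

lemma subalgebra_G: "subalgebra Pr (G t)"
  by (rule subalgebra_FullAlg[OF G_props])

lemma measurable_G_rho: "rho \<in> measurable (G t) (Theta M \<tau>)"
  by (rule measurable_FullAlg_param[OF G_props])

lemma measurable_G_rhohat: "rhohat (t div \<tau>) \<in> measurable (G t) (Theta M \<tau>)"
  by (rule measurable_FullAlg_sample[OF G_props]) simp

lemma measurable_G_hist_act:
  "(\<lambda>\<omega>. (histS S t \<omega>, histA Act (Suc t) \<omega>)) \<in> measurable (G t) (count_space UNIV)"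
  by (rule measurable_FullAlg_hist[OF G_props])

lemma measurable_G_S: "i \<le> t \<Longrightarrow> S i \<in> measurable (G t) (count_space UNIV)"
  using measurable_compose[OF measurable_G_hist_act[of t], of "\<lambda>h. fst h ! i" "count_space UNIV"]
  by (simp add: histS_def nth_map del: upt_Suc)

lemma measurable_G_Act: "i \<le> t \<Longrightarrow> Act i \<in> measurable (G t) (count_space UNIV)"
  using measurable_compose[OF measurable_G_hist_act[of t], of "\<lambda>h. snd h ! i" "count_space UNIV"]
  by (simp add: histA_def nth_map del: upt_Suc)

lemma measurable_G_hist: "hist S Act t \<in> measurable (G t) (count_space UNIV)"
proof -
  have "(\<lambda>\<omega>. (map (\<lambda>i. S i \<omega>) [0..<Suc t], map (\<lambda>i. Act i \<omega>) [0..<t]))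
      \<in> measurable (G t) (count_space UNIV)"
    by (intro measurable_Pair_countable measurable_history measurable_G_S measurable_G_Act) auto
  moreover have "hist S Act t = (\<lambda>\<omega>. (map (\<lambda>i. S i \<omega>) [0..<Suc t], map (\<lambda>i. Act i \<omega>) [0..<t]))"
    by (auto simp: hist_def histS_def histA_def)
  ultimately show ?thesis by (simp del: upt_Suc)
qed

lemma sigma_finite_subalgebraI: "subalgebra Pr F \<Longrightarrow> sigma_finite_subalgebra Pr F"
  by (intro finite_measure_subalgebra_is_sigma_finite finite_measure_subalgebra.intro
      finite_measure_subalgebra_axioms.intro finite_measure_axioms)

lemma subalgebra_HistAlg: "subalgebra Pr (HistAlg Pr S Act t)"
  unfolding HistAlg_def by (rule subalgebra_vimage_algebra[OF measurable_hist])

lemma measurable_HistAlg: "hist S Act t \<in> measurable (HistAlg Pr S Act t) (count_space UNIV)"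
  unfolding HistAlg_def by (rule vimage_algebra_measurable[OF measurable_hist])

lemma integrable_bounded:
  fixes f :: "'w \<Rightarrow> real"
  assumes "f \<in> borel_measurable Pr" "AE \<omega> in Pr. \<bar>f \<omega>\<bar> \<le> C"
  shows "integrable Pr f"
  using assms by (intro integrable_const_bound[where B = C]) auto

text \<open>The form in which \<open>dyn\<close>, \<open>post_cond\<close> and
  \<open>sampling\<close> are applied: under a bounded \<open>F\<close>-measurable weight,
  \<open>f\<close> may be traded for any version \<open>g\<close> of its conditional
  expectation.\<close>

lemma expectation_cond:
  fixes W f g :: "'w \<Rightarrow> real"
  assumes F: "subalgebra Pr F" and W: "W \<in> borel_measurable F" "AE \<omega> in Pr. \<bar>W \<omega>\<bar> \<le> C"
    and f: "f \<in> borel_measurable Pr" "AE \<omega> in Pr. \<bar>f \<omega>\<bar> \<le> 1"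
    and g: "AE \<omega> in Pr. real_cond_exp Pr F f \<omega> = g \<omega>" "g \<in> borel_measurable Pr"
  shows "expectation (\<lambda>\<omega>. W \<omega> * f \<omega>) = expectation (\<lambda>\<omega>. W \<omega> * g \<omega>)"
    and "integrable Pr (\<lambda>\<omega>. W \<omega> * g \<omega>)"
proof -
  interpret F: sigma_finite_subalgebra Pr F
    by (rule sigma_finite_subalgebraI[OF F])
  have W': "W \<in> borel_measurable Pr"
    using W(1) F by (rule measurable_from_subalg[rotated])
  have int: "integrable Pr (\<lambda>\<omega>. W \<omega> * f \<omega>)"
  proof (rule integrable_bounded[where C = C])
    show "AE \<omega> in Pr. \<bar>W \<omega> * f \<omega>\<bar> \<le> C"
      using W(2) f(2)
    proof eventually_elim
      case (elim \<omega>)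
      then have "\<bar>W \<omega>\<bar> * \<bar>f \<omega>\<bar> \<le> C * 1"
        by (intro mult_mono) auto
      then show ?case by (simp add: abs_mult)
    qed
  qed (use W' f in auto)
  have ae: "AE \<omega> in Pr. W \<omega> * real_cond_exp Pr F f \<omega> = W \<omega> * g \<omega>"
    using g(1) by eventually_elim simp
  have "expectation (\<lambda>\<omega>. W \<omega> * f \<omega>) = expectation (\<lambda>\<omega>. W \<omega> * real_cond_exp Pr F f \<omega>)"
    by (rule F.real_cond_exp_intg(2)[OF int W(1) f(1), symmetric])
  also have "\<dots> = expectation (\<lambda>\<omega>. W \<omega> * g \<omega>)"
    using ae W' g by (intro integral_cong_AE) (auto intro: borel_measurable_cond_exp2)
  finally show "expectation (\<lambda>\<omega>. W \<omega> * f \<omega>) = expectation (\<lambda>\<omega>. W \<omega> * g \<omega>)" .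
  show "integrable Pr (\<lambda>\<omega>. W \<omega> * g \<omega>)"
    by (rule integrable_cong_AE_imp[OF F.real_cond_exp_intg(1)[OF int W(1) f(1)] _ ae]) (use W' g in auto)
qed

lemma
  assumes "W \<in> borel_measurable (G t)" "AE \<omega> in Pr. \<bar>W \<omega>\<bar> \<le> C"
  shows expectation_step: "expectation (\<lambda>\<omega>. W \<omega> * indicator {s'} (S (Suc t) \<omega>)) =
      expectation (\<lambda>\<omega>. W \<omega> * transP M \<tau> s0 (rho \<omega>) (S t \<omega>) (Act t \<omega>) s')"
    and integrable_step: "integrable Pr (\<lambda>\<omega>. W \<omega> * transP M \<tau> s0 (rho \<omega>) (S t \<omega>) (Act t \<omega>) s')"
  by (rule expectation_cond[OF subalgebra_G assms _ _ dyn measurable_transP];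
      auto simp: indicator_def)+

text \<open>For a fixed \<open>s'\<close>, the indicator \<open>W\<close> of "the transition to
  \<open>s'\<close> has probability zero" is known before the transition. Weighting by it makes the
  expected transition probability vanish, so such a transition is a null event; there are countably
  many \<open>s'\<close>.\<close>

lemma AE_step:
  "AE \<omega> in Pr. transP M \<tau> s0 (rho \<omega>) (S t \<omega>) (Act t \<omega>) (S (Suc t) \<omega>) \<noteq> 0"
proof -
  have "AE \<omega> in Pr. \<not> (S (Suc t) \<omega> = s' \<and> transP M \<tau> s0 (rho \<omega>) (S t \<omega>) (Act t \<omega>) s' = 0)" for s'
  proof -
    define W where "W \<omega> = (if transP M \<tau> s0 (rho \<omega>) (S t \<omega>) (Act t \<omega>) s' = 0 then 1 else 0 :: real)" for \<omega>
    have [measurable]: "(\<lambda>\<omega>. transP M \<tau> s0 (rho \<omega>) (S t \<omega>) (Act t \<omega>) s') \<in> borel_measurable (G t)"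
      by (intro measurable_transP measurable_G_rho measurable_G_S measurable_G_Act) auto
    have W: "W \<in> borel_measurable (G t)"
      unfolding W_def by measurable
    have W': "W \<in> borel_measurable Pr"
      using W subalgebra_G by (rule measurable_from_subalg[rotated])
    have "expectation (\<lambda>\<omega>. W \<omega> * indicator {s'} (S (Suc t) \<omega>)) =
        expectation (\<lambda>\<omega>. W \<omega> * transP M \<tau> s0 (rho \<omega>) (S t \<omega>) (Act t \<omega>) s')"
      by (rule expectation_step[OF W, where C = 1]) (auto simp: W_def)
    also have "(\<lambda>\<omega>. W \<omega> * transP M \<tau> s0 (rho \<omega>) (S t \<omega>) (Act t \<omega>) s') = (\<lambda>_. 0)"
      by (auto simp: W_def)
    finally have "expectation (\<lambda>\<omega>. W \<omega> * indicator {s'} (S (Suc t) \<omega>)) = 0" by simp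
    moreover have "integrable Pr (\<lambda>\<omega>. W \<omega> * indicator {s'} (S (Suc t) \<omega>))"
    proof (rule integrable_bounded[where C = 1])
      show "(\<lambda>\<omega>. W \<omega> * indicator {s'} (S (Suc t) \<omega>)) \<in> borel_measurable Pr"
        using W' measurable_compose[OF meas_S[of "Suc t"], of "indicator {s'} :: _ \<Rightarrow> real" borel] by auto
    qed (auto simp: W_def indicator_def)
    ultimately have "AE \<omega> in Pr. W \<omega> * indicator {s'} (S (Suc t) \<omega>) = 0"
      by (subst (asm) integral_nonneg_eq_0_iff_AE) (auto simp: W_def)
    then show ?thesis
      by eventually_elim (auto simp: W_def)
  qed
  then have "AE \<omega> in Pr. \<forall>s'. \<not> (S (Suc t) \<omega> = s' \<and> transP M \<tau> s0 (rho \<omega>) (S t \<omega>) (Act t \<omega>) s' = 0)"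
    by (subst AE_all_countable) auto
  then show ?thesis
    by eventually_elim auto
qed

lemma AE_next_state:
  "AE \<omega> in Pr. S (Suc t) \<omega> \<in> (if snd (S t \<omega>) = \<tau> - 1 then {s0}
     else {nxt_up M \<tau> (S t \<omega>), nxt_down M \<tau> (S t \<omega>)})"
  using AE_step[of t] by eventually_elim (auto simp: transP_def split: if_splits)

text \<open>The layer is a deterministic clock. This is what places time \<open>t\<close> in episode
  \<open>t div \<tau>\<close>, bounds the values along the trajectory and rules out repeated states
  within an episode.\<close>

lemma AE_state: "AE \<omega> in Pr. fst (S t \<omega>) < M \<and> snd (S t \<omega>) = t mod \<tau>"
proof (induction t)
  case 0
  show ?case using init by eventually_elim (use s0 in auto)
next
  case (Suc t)
  show ?case using Suc AE_next_state[of t]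
  proof eventually_elim
    case (elim \<omega>)
    show ?case
    proof (cases "snd (S t \<omega>) = \<tau> - 1")
      case True
      then have "Suc t mod \<tau> = 0"
        using elim tau by (simp add: mod_Suc)
      then show ?thesis using True elim s0 by simp
    next
      case False
      then show ?thesis using elim M by (auto simp: mod_Suc_eq)
    qed
  qed
qed

lemma AE_param: "AE \<omega> in Pr. valid_param M \<tau> (rho \<omega>)"
proof -
  have "AE \<omega> in Pr. 0 \<le> rho \<omega> x \<and> rho \<omega> x \<le> 1" if x: "x \<in> paramidx M \<tau>" for x
  proof -
    interpret U: prob_space "uniform_measure lborel {0..1::real}"
      by (rule prob_space_uniform_measure) auto
    have "AE y in uniform_measure lborel {0..1::real}. 0 \<le> y \<and> y \<le> 1"
      by (subst AE_uniform_measure) auto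
    then have "AE p in PiM (paramidx M \<tau>) (\<lambda>_. uniform_measure lborel {0..1::real}). 0 \<le> p x \<and> p x \<le> 1"
      using x U.prob_space_axioms by (intro AE_PiM_component) auto
    then have "AE p in distr Pr (Theta M \<tau>) rho. 0 \<le> p x \<and> p x \<le> 1"
      unfolding prior .
    then show ?thesis
      by (rule AE_distrD[rotated]) measurable
  qed
  then have "AE \<omega> in Pr. \<forall>x\<in>paramidx M \<tau>. 0 \<le> rho \<omega> x \<and> rho \<omega> x \<le> 1"
    by (intro AE_finite_allI finite_paramidx)
  then show ?thesis by (simp add: valid_param_def)
qed

section \<open>Exchanging the parameter and the sample given the history\<close>

lemma posterior_sampling_hist:
  assumes B: "B \<in> sets (Theta M \<tau>)"
  shows "prob {\<omega> \<in> space Pr. hist S Act (l * \<tau>) \<omega> = h \<and> rhohat l \<omega> \<in> B} =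
    prob {\<omega> \<in> space Pr. hist S Act (l * \<tau>) \<omega> = h \<and> rho \<omega> \<in> B}"
proof -
  let ?H = "hist S Act (l * \<tau>)"
  let ?W = "\<lambda>\<omega>. indicator {h} (?H \<omega>) :: real"
  let ?g = "\<lambda>\<omega>. measure (post (l * \<tau>) \<omega>) B"
  note [measurable] = B measurable_hist
  have sub: "subalgebra Pr (FullAlg Pr M \<tau> rho ?H rhohat l)"
    by (rule subalgebra_FullAlg[OF meas_rho measurable_hist meas_rhohat])
  have Wf: "?W \<in> borel_measurable (FullAlg Pr M \<tau> rho ?H rhohat l)"
    using measurable_compose[OF measurable_FullAlg_hist[OF meas_rho measurable_hist meas_rhohat],
        of "\<lambda>x. indicator {h} x" borel] by simp
  have Wh: "?W \<in> borel_measurable (HistAlg Pr S Act (l * \<tau>))"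
    using measurable_compose[OF measurable_HistAlg, of "\<lambda>x. indicator {h} x" borel] by simp
  have "post (l * \<tau>) \<in> measurable Pr (prob_algebra (Theta M \<tau>))"
    using post_meas subalgebra_HistAlg by (rule measurable_from_subalg[rotated])
  then have "post (l * \<tau>) \<in> measurable Pr (subprob_algebra (Theta M \<tau>))"
    by (rule measurable_prob_algebraD)
  then have g: "?g \<in> borel_measurable Pr"
    by (rule measurable_compose) (rule measurable_measure_subprob_algebra[OF B])
  have ind: "(\<lambda>\<omega>. indicator B (rhohat l \<omega>) :: real) \<in> borel_measurable Pr"
      "(\<lambda>\<omega>. indicator B (rho \<omega>) :: real) \<in> borel_measurable Pr"
    by measurable
  \<comment> \<open>The kernel \<open>post\<close> is the common middle term: it is the conditional
    law of the sample given the large algebra and of the parameter given the history, and the weight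
    \<open>?W\<close> is measurable for both.\<close>
  have "expectation (\<lambda>\<omega>. ?W \<omega> * indicator B (rhohat l \<omega>)) = expectation (\<lambda>\<omega>. ?W \<omega> * ?g \<omega>)"
    by (rule expectation_cond(1)[OF sub Wf _ ind(1) _ sampling[OF B] g, of 1]) (auto simp: indicator_def)
  also have "\<dots> = expectation (\<lambda>\<omega>. ?W \<omega> * indicator B (rho \<omega>))"
    by (rule expectation_cond(1)[symmetric, OF subalgebra_HistAlg Wh _ ind(2) _ post_cond[OF B] g, of 1])
      (auto simp: indicator_def)
  finally have *: "expectation (\<lambda>\<omega>. ?W \<omega> * indicator B (rhohat l \<omega>)) =
      expectation (\<lambda>\<omega>. ?W \<omega> * indicator B (rho \<omega>))" .
  have "prob {\<omega> \<in> space Pr. ?H \<omega> = h \<and> f \<omega> \<in> B} = expectation (\<lambda>\<omega>. ?W \<omega> * indicator B (f \<omega>))"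
    if [measurable]: "f \<in> measurable Pr (Theta M \<tau>)" for f
  proof -
    have "expectation (\<lambda>\<omega>. ?W \<omega> * indicator B (f \<omega>)) =
        expectation (indicator {\<omega> \<in> space Pr. ?H \<omega> = h \<and> f \<omega> \<in> B})"
      by (intro Bochner_Integration.integral_cong) (auto simp: indicator_def)
    also have "\<dots> = prob {\<omega> \<in> space Pr. ?H \<omega> = h \<and> f \<omega> \<in> B}"
      by (auto intro!: arg_cong[where f = prob])
    finally show ?thesis ..
  qed
  with * show ?thesis by simp
qed

text \<open>Summing the fixed-history identity over the countably many histories allows the set to
  depend on the history, as a confidence set does.\<close>

lemma posterior_sampling:
  assumes B: "\<And>h. B h \<in> sets (Theta M \<tau>)"
  shows "prob {\<omega> \<in> space Pr. rhohat l \<omega> \<in> B (hist S Act (l * \<tau>) \<omega>)} =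
    prob {\<omega> \<in> space Pr. rho \<omega> \<in> B (hist S Act (l * \<tau>) \<omega>)}"
proof -
  let ?H = "hist S Act (l * \<tau>)"
  note [measurable] = B measurable_hist
  have split: "emeasure Pr {\<omega> \<in> space Pr. f \<omega> \<in> B (?H \<omega>)} =
      (\<integral>\<^sup>+h. prob {\<omega> \<in> space Pr. ?H \<omega> = h \<and> f \<omega> \<in> B h} \<partial>count_space UNIV)"
    if [measurable]: "f \<in> measurable Pr (Theta M \<tau>)" for f
  proof -
    have "{\<omega> \<in> space Pr. f \<omega> \<in> B (?H \<omega>)} = (\<Union>h. {\<omega> \<in> space Pr. ?H \<omega> = h \<and> f \<omega> \<in> B h})"
      by auto
    also have "emeasure Pr \<dots> =
        (\<integral>\<^sup>+h. emeasure Pr {\<omega> \<in> space Pr. ?H \<omega> = h \<and> f \<omega> \<in> B h} \<partial>count_space UNIV)"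
      by (rule emeasure_UN_countable) (auto simp: disjoint_family_on_def)
    finally show ?thesis by (simp add: emeasure_eq_measure)
  qed
  have "emeasure Pr {\<omega> \<in> space Pr. rhohat l \<omega> \<in> B (?H \<omega>)} = emeasure Pr {\<omega> \<in> space Pr. rho \<omega> \<in> B (?H \<omega>)}"
    by (simp only: split[OF meas_rho] split[OF meas_rhohat] posterior_sampling_hist[OF B])
  then show ?thesis by (simp add: measure_def)
qed

lemma sets_valid_param: "{p :: (nat \<times> nat) \<times> 'a \<Rightarrow> real. p \<in> space (Theta M \<tau>) \<and> valid_param M \<tau> p} \<in> sets (Theta M \<tau>)"
proof -
  have [measurable]: "(\<lambda>p. p x) \<in> borel_measurable (Theta M \<tau>)" for x :: "(nat \<times> nat) \<times> 'a"
    by (rule measurable_Theta_component[where M = M and \<tau> = \<tau>]) simp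
  show ?thesis
    unfolding valid_param_def by (intro sets.sets_Collect_finite_All finite_paramidx) measurable
qed

text \<open>Almost sure properties of the parameter pass to the sample: apply the exchange to a set
  that does not depend on the history.\<close>

lemma AE_sample: "AE \<omega> in Pr. valid_param M \<tau> (rhohat l \<omega>)"
proof -
  let ?B = "space (Theta M \<tau>) - {p :: (nat \<times> nat) \<times> 'a \<Rightarrow> real. p \<in> space (Theta M \<tau>) \<and> valid_param M \<tau> p}"
  have B: "?B \<in> sets (Theta M \<tau>)"
    by (intro sets.Diff sets.top sets_valid_param)
  have "prob {\<omega> \<in> space Pr. rho \<omega> \<in> ?B} = 0"
    using AE_param B by (intro prob_eq_0_AE) auto
  then have "prob {\<omega> \<in> space Pr. rhohat l \<omega> \<in> ?B} = 0"
    using posterior_sampling[OF B] by simp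
  then have "AE \<omega> in Pr. rhohat l \<omega> \<notin> ?B"
    by (subst (asm) prob_eq_0) (use B in measurable)
  then show ?thesis
    using measurable_space[OF meas_rhohat] by (auto elim!: AE_mp)
qed

end

section \<open>Regret and parameter errors\<close>

context thompson_mdp
begin

lemma AE_good:
  "AE \<omega> in Pr. valid_param M \<tau> (rho \<omega>) \<and> (\<forall>l. valid_param M \<tau> (rhohat l \<omega>))
     \<and> (\<forall>t. fst (S t \<omega>) < M \<and> snd (S t \<omega>) = t mod \<tau>)"
proof -
  have "AE \<omega> in Pr. \<forall>l. valid_param M \<tau> (rhohat l \<omega>)"
    using AE_sample by (subst AE_all_countable) auto
  moreover have "AE \<omega> in Pr. \<forall>t. fst (S t \<omega>) < M \<and> snd (S t \<omega>) = t mod \<tau>"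
    using AE_state by (subst AE_all_countable) auto
  ultimately show ?thesis
    using AE_param by eventually_elim auto
qed

lemma mod_less: "t mod \<tau> < \<tau>"
  using tau by simp

lemma value_bounds:
  assumes "valid_param M \<tau> p" "fst s < M" "snd s < \<tau>"
  shows "0 \<le> Qfun M \<tau> s0 r p s a" "Qfun M \<tau> s0 r p s a \<le> real \<tau>"
    and "0 \<le> Vfun M \<tau> s0 r p s" "Vfun M \<tau> s0 r p s \<le> real (\<tau> - snd s)" "Vfun M \<tau> s0 r p s \<le> real \<tau>"
proof -
  show V: "0 \<le> Vfun M \<tau> s0 r p s" "Vfun M \<tau> s0 r p s \<le> real (\<tau> - snd s)"
    by (rule Vfun_bounds; fact assms M r)+
  show "0 \<le> Qfun M \<tau> s0 r p s a"
    by (rule Qfun_bounds; fact assms M r)+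
  show "Vfun M \<tau> s0 r p s \<le> real \<tau>"
    using V(2) by (rule order_trans) simp
  with Qfun_le_Vfun show "Qfun M \<tau> s0 r p s a \<le> real \<tau>"
    by (rule order_trans)
qed

lemma integrable_values:
  assumes f: "f \<in> measurable Pr (Theta M \<tau>)" "AE \<omega> in Pr. valid_param M \<tau> (f \<omega>)"
  shows "integrable Pr (\<lambda>\<omega>. Qfun M \<tau> s0 r (f \<omega>) (S t \<omega>) (Act t \<omega>))"
    and "integrable Pr (\<lambda>\<omega>. Vfun M \<tau> s0 r (f \<omega>) (S t \<omega>))"
proof -
  have "AE \<omega> in Pr. \<bar>Qfun M \<tau> s0 r (f \<omega>) (S t \<omega>) (Act t \<omega>)\<bar> \<le> real \<tau>
      \<and> \<bar>Vfun M \<tau> s0 r (f \<omega>) (S t \<omega>)\<bar> \<le> real \<tau>"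
    using f(2) AE_good
  proof eventually_elim
    case (elim \<omega>)
    then have "fst (S t \<omega>) < M" "snd (S t \<omega>) < \<tau>"
      using mod_less by auto
    with elim show ?case
      using value_bounds(1,2)[of "f \<omega>" "S t \<omega>" "Act t \<omega>"] value_bounds(3,5)[of "f \<omega>" "S t \<omega>"] by simp
  qed
  then show "integrable Pr (\<lambda>\<omega>. Qfun M \<tau> s0 r (f \<omega>) (S t \<omega>) (Act t \<omega>))"
    "integrable Pr (\<lambda>\<omega>. Vfun M \<tau> s0 r (f \<omega>) (S t \<omega>))"
    by (intro integrable_bounded[where C = "real \<tau>"] measurable_Qfun measurable_Vfun f meas_S meas_A;
        auto elim: AE_mp)+
qed

lemmas integrable_rho = integrable_values[OF meas_rho AE_param]
lemmas integrable_rhohat = integrable_values[OF meas_rhohat AE_sample]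

definition regret :: "nat \<Rightarrow> real" where
  "regret t = expectation (\<lambda>\<omega>. Vfun M \<tau> s0 r (rho \<omega>) (S t \<omega>) - Qfun M \<tau> s0 r (rho \<omega>) (S t \<omega>) (Act t \<omega>))"

definition gap :: "nat \<Rightarrow> real" where
  "gap t = expectation (\<lambda>\<omega>. Qfun M \<tau> s0 r (rhohat (t div \<tau>) \<omega>) (S t \<omega>) (Act t \<omega>)
     - Qfun M \<tau> s0 r (rho \<omega>) (S t \<omega>) (Act t \<omega>))"

text \<open>For \<^term>\<open>M \<le> 2\<close> the two successors of a state coincide: the parameter is then irrelevant
  for the values, and it cannot be learned either, so its error has to be counted as zero.\<close>

definition informative :: "((nat \<times> nat) \<times> 'a) set" where
  "informative = {x \<in> paramidx M \<tau>. nxt_up M \<tau> (fst x) \<noteq> nxt_down M \<tau> (fst x)}"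

definition err :: "nat \<Rightarrow> 'w \<Rightarrow> real" where
  "err t \<omega> = (if (S t \<omega>, Act t \<omega>) \<in> informative
     then \<bar>rhohat (t div \<tau>) \<omega> (S t \<omega>, Act t \<omega>) - rho \<omega> (S t \<omega>, Act t \<omega>)\<bar> else 0)"

lemma regret_nonneg: "0 \<le> regret t"
  unfolding regret_def by (intro Bochner_Integration.integral_nonneg) (simp add: Qfun_le_Vfun)

lemma regret_le: "regret t \<le> real \<tau>"
proof -
  have "AE \<omega> in Pr. Vfun M \<tau> s0 r (rho \<omega>) (S t \<omega>) - Qfun M \<tau> s0 r (rho \<omega>) (S t \<omega>) (Act t \<omega>) \<le> real \<tau>"
    using AE_good
  proof eventually_elim
    case (elim \<omega>)
    then have "fst (S t \<omega>) < M" "snd (S t \<omega>) < \<tau>"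
      using mod_less by auto
    with elim show ?case
      using value_bounds(1,2)[of "rho \<omega>" "S t \<omega>" "Act t \<omega>"] value_bounds(3,5)[of "rho \<omega>" "S t \<omega>"] by linarith
  qed
  then have "regret t \<le> expectation (\<lambda>_. real \<tau>)"
    unfolding regret_def by (intro integral_mono_AE Bochner_Integration.integrable_diff integrable_rho) auto
  then show ?thesis by (simp add: prob_space)
qed

text \<open>Integrating both sides removes the conditioning in the optimism hypothesis; greediness
  then turns the sampled value at \<open>S t\<close> into the sampled Q-value of the action actually
  taken.\<close>

lemma regret_le_gap: "regret t \<le> gap t"
proof -
  define l where "l = t div \<tau>"
  let ?F = "vimage_algebra (space Pr) (post (l * \<tau>)) (prob_algebra (Theta M \<tau>))"
  have "post (l * \<tau>) \<in> measurable Pr (prob_algebra (Theta M \<tau>))"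
    using post_meas subalgebra_HistAlg by (rule measurable_from_subalg[rotated])
  then have "subalgebra Pr ?F"
    by (rule subalgebra_vimage_algebra)
  then interpret F: sigma_finite_subalgebra Pr ?F
    by (rule sigma_finite_subalgebraI)
  have "l * \<tau> \<le> t" "t < Suc l * \<tau>"
    using tau dividend_less_times_div[of \<tau> t] by (auto simp: l_def mult.commute)
  note opt = optimism[OF this]
  have "expectation (\<lambda>\<omega>. Vfun M \<tau> s0 r (rho \<omega>) (S t \<omega>)) =
      expectation (real_cond_exp Pr ?F (\<lambda>\<omega>. Vfun M \<tau> s0 r (rho \<omega>) (S t \<omega>)))"
    by (rule F.real_cond_exp_int(2)[symmetric, OF integrable_rho(2)])
  also have "\<dots> \<le> expectation (real_cond_exp Pr ?F (\<lambda>\<omega>. Vfun M \<tau> s0 r (rhohat l \<omega>) (S t \<omega>)))"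
    by (intro integral_mono_AE F.real_cond_exp_int(1) integrable_rho integrable_rhohat opt)
  also have "\<dots> = expectation (\<lambda>\<omega>. Vfun M \<tau> s0 r (rhohat l \<omega>) (S t \<omega>))"
    by (rule F.real_cond_exp_int(2)[OF integrable_rhohat(2)])
  also have "\<dots> = expectation (\<lambda>\<omega>. Qfun M \<tau> s0 r (rhohat l \<omega>) (S t \<omega>) (Act t \<omega>))"
    using greedy[of t] integrable_rhohat[of l t]
    by (intro integral_cong_AE) (auto simp: l_def elim: AE_mp)
  finally show ?thesis
    unfolding regret_def gap_def l_def
    by (simp add: Bochner_Integration.integral_diff integrable_rho integrable_rhohat)
qed

lemma finite_informative: "finite informative"
  unfolding informative_def using finite_paramidx[of M \<tau>, where 'a = 'a] by simp

lemma card_informative_le: "card informative \<le> M * \<tau> * CARD('a)"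
  using card_mono[OF finite_paramidx, of informative M \<tau>] card_paramidx_le[of M \<tau>, where 'a = 'a]
  by (auto simp: informative_def)

lemma measurable_err: "err t \<in> borel_measurable Pr"
proof -
  have "(\<lambda>\<omega>. if (s, a) \<in> informative then \<bar>rhohat (t div \<tau>) \<omega> (s, a) - rho \<omega> (s, a)\<bar> else 0)
      \<in> borel_measurable Pr" for s a
    using measurable_Theta_component[OF meas_rho] measurable_Theta_component[OF meas_rhohat] by auto
  then have "(\<lambda>\<omega>. if (S t \<omega>, a) \<in> informative then \<bar>rhohat (t div \<tau>) \<omega> (S t \<omega>, a) - rho \<omega> (S t \<omega>, a)\<bar> else 0)
      \<in> borel_measurable Pr" for a
    by (rule measurable_compose_countable) (rule meas_S)
  then show ?thesis
    unfolding err_def by (rule measurable_compose_countable) (rule meas_A)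
qed

lemma err_le_1: "AE \<omega> in Pr. err t \<omega> \<le> 1"
  using AE_good
proof eventually_elim
  case (elim \<omega>)
  then show ?case
    by (auto simp: err_def informative_def valid_param_def abs_le_iff)
      (smt (verit, best))+
qed

lemma err_nonneg: "0 \<le> err t \<omega>"
  by (simp add: err_def)

lemma integrable_err: "integrable Pr (err t)"
  using err_le_1[of t] measurable_err err_nonneg
  by (intro integrable_bounded[where C = 1]) (auto elim: AE_mp)

text \<open>Subtracting the Bellman equations and adding and subtracting the
  \<open>p\<close>-average of the \<open>q\<close>-values splits off the parameter error times
  \<open>?U\<close> at the upper minus \<open>?U\<close> at the lower successor. Both lie in the
  interval from 0 to \<open>\<tau> - snd s\<close>, so their difference costs one horizon rather
  than two; it vanishes when the successors coincide. What remains is a gap one layer later,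
  averaged under the true \<open>p\<close>.\<close>

lemma Qfun_diff_le:
  assumes p: "valid_param M \<tau> p" "valid_param M \<tau> q" and s: "fst s < M" "snd s < \<tau> - 1"
  defines "D \<equiv> (\<lambda>s'. Vfun M \<tau> s0 r q s' - Vfun M \<tau> s0 r p s')"
  shows "Qfun M \<tau> s0 r q s a - Qfun M \<tau> s0 r p s a \<le>
      real (\<tau> - snd s) * (if (s, a) \<in> informative then \<bar>q (s, a) - p (s, a)\<bar> else 0)
    + (p (s, a) * D (nxt_up M \<tau> s) + (1 - p (s, a)) * D (nxt_down M \<tau> s))"
proof -
  let ?U = "\<lambda>s'. r s a s' + Vfun M \<tau> s0 r q s'"
  have U: "0 \<le> ?U s'" "?U s' \<le> real (\<tau> - snd s)" if "fst s' < M" "snd s' = Suc (snd s) mod \<tau>" for s'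
  proof -
    have "snd s' = Suc (snd s)" using that s by simp
    then have "snd s' < \<tau>" "real (\<tau> - snd s') = real (\<tau> - snd s) - 1"
      using s by (auto simp: of_nat_diff)
    then show "0 \<le> ?U s'" "?U s' \<le> real (\<tau> - snd s)"
      using r[of s a s'] value_bounds(3,4)[OF p(2) that(1)] by auto
  qed
  have "\<bar>?U (nxt_up M \<tau> s) - ?U (nxt_down M \<tau> s)\<bar> \<le> real (\<tau> - snd s)"
    using U[of "nxt_up M \<tau> s"] U[of "nxt_down M \<tau> s"] M by auto
  then have "\<bar>q (s, a) - p (s, a)\<bar> * \<bar>?U (nxt_up M \<tau> s) - ?U (nxt_down M \<tau> s)\<bar>
      \<le> \<bar>q (s, a) - p (s, a)\<bar> * real (\<tau> - snd s)"
    by (intro mult_left_mono) auto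
  then have le: "(q (s, a) - p (s, a)) * (?U (nxt_up M \<tau> s) - ?U (nxt_down M \<tau> s))
      \<le> real (\<tau> - snd s) * (if (s, a) \<in> informative then \<bar>q (s, a) - p (s, a)\<bar> else 0)"
  proof (cases "nxt_up M \<tau> s = nxt_down M \<tau> s")
    case False
    then have "(s, a) \<in> informative" using s by (simp add: informative_def paramidx_iff)
    have "(q (s, a) - p (s, a)) * (?U (nxt_up M \<tau> s) - ?U (nxt_down M \<tau> s)) \<le>
        \<bar>(q (s, a) - p (s, a)) * (?U (nxt_up M \<tau> s) - ?U (nxt_down M \<tau> s))\<bar>"
      by (rule abs_ge_self)
    also have "\<dots> \<le> \<bar>q (s, a) - p (s, a)\<bar> * real (\<tau> - snd s)"
      using \<open>\<bar>q (s, a) - p (s, a)\<bar> * _ \<le> _\<close> by (simp only: abs_mult)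
    finally show ?thesis
      using \<open>(s, a) \<in> informative\<close> by (simp add: mult.commute)
  qed simp
  have "Qfun M \<tau> s0 r q s a - Qfun M \<tau> s0 r p s a =
      (q (s, a) - p (s, a)) * (?U (nxt_up M \<tau> s) - ?U (nxt_down M \<tau> s))
    + (p (s, a) * D (nxt_up M \<tau> s) + (1 - p (s, a)) * D (nxt_down M \<tau> s))"
    unfolding Qfun_step[OF s(2)] D_def by (simp add: algebra_simps)
  with le show ?thesis by linarith
qed

lemma gap_step:
  assumes t: "t mod \<tau> < \<tau> - 1"
  shows "gap t \<le> real (\<tau> - t mod \<tau>) * expectation (err t) + gap (Suc t)"
proof -
  define l where "l = t div \<tau>"
  define D where "D s' \<omega> = Vfun M \<tau> s0 r (rhohat l \<omega>) s' - Vfun M \<tau> s0 r (rho \<omega>) s'" for s' \<omega>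
  define p where "p \<omega> = rho \<omega> (S t \<omega>, Act t \<omega>)" for \<omega>
  let ?P = "\<lambda>s' \<omega>. transP M \<tau> s0 (rho \<omega>) (S t \<omega>) (Act t \<omega>) s'"
  let ?X = "{..<M} \<times> {..<\<tau>}"
  \<comment> \<open>Before the last layer the next time lies in the same episode, so the same sample
    governs both gaps.\<close>
  have divS: "Suc t div \<tau> = l"
    using t by (simp add: l_def div_Suc mod_Suc)
  have D_meas: "D s' \<in> borel_measurable (G t)" for s'
    unfolding D_def[abs_def] l_def
    by (intro borel_measurable_diff measurable_Vfun measurable_G_rho measurable_G_rhohat) auto
  have D_bound: "AE \<omega> in Pr. \<bar>D s' \<omega>\<bar> \<le> real \<tau>" if "s' \<in> ?X" for s'
    using AE_good
  proof eventually_elim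
    case (elim \<omega>)
    then show ?case
      using value_bounds(3,5)[of "rho \<omega>" s'] value_bounds(3,5)[of "rhohat l \<omega>" s'] that
      by (auto simp: D_def abs_le_iff mem_Times_iff)
  qed
  have int1: "integrable Pr (\<lambda>\<omega>. D s' \<omega> * ?P s' \<omega>)" if "s' \<in> ?X" for s'
    by (rule integrable_step[OF D_meas D_bound[OF that]])
  have int2: "integrable Pr (\<lambda>\<omega>. D s' \<omega> * indicator {s'} (S (Suc t) \<omega>))" if "s' \<in> ?X" for s'
  proof (rule integrable_bounded[where C = "real \<tau>"])
    show "(\<lambda>\<omega>. D s' \<omega> * indicator {s'} (S (Suc t) \<omega>)) \<in> borel_measurable Pr"
      using measurable_from_subalg[OF subalgebra_G D_meas]
        measurable_compose[OF meas_S[of "Suc t"], of "indicator {s'} :: _ \<Rightarrow> real" borel] by auto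
    show "AE \<omega> in Pr. \<bar>D s' \<omega> * indicator {s'} (S (Suc t) \<omega>)\<bar> \<le> real \<tau>"
      using D_bound[OF that] by eventually_elim (auto simp: indicator_def)
  qed
  \<comment> \<open>At a fixed \<open>s'\<close> the value difference is known before the
    transition, so the true transition probabilities can be replaced by the state actually reached.
    There greediness gives equality for the sampled value, while the true value dominates the true
    Q-value.\<close>
  have "expectation (\<lambda>\<omega>. \<Sum>s'\<in>?X. D s' \<omega> * ?P s' \<omega>) =
      expectation (\<lambda>\<omega>. \<Sum>s'\<in>?X. D s' \<omega> * indicator {s'} (S (Suc t) \<omega>))"
    using int1 int2 expectation_step[OF D_meas D_bound]
    by (subst (1 2) Bochner_Integration.integral_sum) (auto intro!: sum.cong)
  also have "\<dots> = expectation (\<lambda>\<omega>. Vfun M \<tau> s0 r (rhohat l \<omega>) (S (Suc t) \<omega>) - Vfun M \<tau> s0 r (rho \<omega>) (S (Suc t) \<omega>))"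
  proof (rule integral_cong_AE)
    show "AE \<omega> in Pr. (\<Sum>s'\<in>?X. D s' \<omega> * indicator {s'} (S (Suc t) \<omega>)) =
        Vfun M \<tau> s0 r (rhohat l \<omega>) (S (Suc t) \<omega>) - Vfun M \<tau> s0 r (rho \<omega>) (S (Suc t) \<omega>)"
      using AE_state[of "Suc t"]
    proof eventually_elim
      case (elim \<omega>)
      then have "S (Suc t) \<omega> \<in> ?X" using mod_less by (auto simp: mem_Times_iff)
      then have "(\<Sum>s'\<in>?X. D s' \<omega> * indicator {s'} (S (Suc t) \<omega>)) = D (S (Suc t) \<omega>) \<omega>"
        by (subst sum.remove[of _ "S (Suc t) \<omega>"]) (auto intro!: sum.neutral simp: indicator_def)
      then show ?case by (simp add: D_def)
    qed
    show "(\<lambda>\<omega>. \<Sum>s'\<in>?X. D s' \<omega> * indicator {s'} (S (Suc t) \<omega>)) \<in> borel_measurable Pr"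
      using int2 by (intro borel_measurable_sum) auto
  qed (intro borel_measurable_diff measurable_Vfun meas_rho meas_rhohat meas_S)
  also have "\<dots> \<le> gap (Suc t)"
    unfolding gap_def divS
  proof (rule integral_mono_AE)
    show "AE \<omega> in Pr. Vfun M \<tau> s0 r (rhohat l \<omega>) (S (Suc t) \<omega>) - Vfun M \<tau> s0 r (rho \<omega>) (S (Suc t) \<omega>)
        \<le> Qfun M \<tau> s0 r (rhohat l \<omega>) (S (Suc t) \<omega>) (Act (Suc t) \<omega>)
          - Qfun M \<tau> s0 r (rho \<omega>) (S (Suc t) \<omega>) (Act (Suc t) \<omega>)"
      using greedy[of "Suc t"] by eventually_elim (simp add: divS Qfun_le_Vfun)
  qed (intro Bochner_Integration.integrable_diff integrable_rho integrable_rhohat)+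
  finally have next_gap: "expectation (\<lambda>\<omega>. \<Sum>s'\<in>?X. D s' \<omega> * ?P s' \<omega>) \<le> gap (Suc t)" .
  have "gap t \<le> expectation (\<lambda>\<omega>. real (\<tau> - t mod \<tau>) * err t \<omega> + (\<Sum>s'\<in>?X. D s' \<omega> * ?P s' \<omega>))"
    unfolding gap_def l_def[symmetric]
  proof (rule integral_mono_AE)
    show "AE \<omega> in Pr. Qfun M \<tau> s0 r (rhohat l \<omega>) (S t \<omega>) (Act t \<omega>) - Qfun M \<tau> s0 r (rho \<omega>) (S t \<omega>) (Act t \<omega>)
        \<le> real (\<tau> - t mod \<tau>) * err t \<omega> + (\<Sum>s'\<in>?X. D s' \<omega> * ?P s' \<omega>)"
      using AE_good
    proof eventually_elim
      case (elim \<omega>)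
      let ?u = "nxt_up M \<tau> (S t \<omega>)" and ?d = "nxt_down M \<tau> (S t \<omega>)"
      have st: "fst (S t \<omega>) < M" "snd (S t \<omega>) < \<tau> - 1" "snd (S t \<omega>) = t mod \<tau>"
        using elim t by auto
      have ud: "?u \<in> ?X" "?d \<in> ?X"
        using M tau by (auto simp: mem_Times_iff)
      have "(\<Sum>s'\<in>?X. D s' \<omega> * ?P s' \<omega>) =
          (\<Sum>s'\<in>?X. (if s' = ?u then p \<omega> * D s' \<omega> else 0) + (if s' = ?d then (1 - p \<omega>) * D s' \<omega> else 0))"
        using st by (intro sum.cong) (auto simp: transP_def p_def algebra_simps)
      also have "\<dots> = p \<omega> * D ?u \<omega> + (1 - p \<omega>) * D ?d \<omega>"
        using ud by (simp add: sum.distrib sum.delta)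
      finally have eq: "(\<Sum>s'\<in>?X. D s' \<omega> * ?P s' \<omega>) = p \<omega> * D ?u \<omega> + (1 - p \<omega>) * D ?d \<omega>" .
      have "valid_param M \<tau> (rho \<omega>)" "valid_param M \<tau> (rhohat l \<omega>)"
        using elim by auto
      from Qfun_diff_le[OF this st(1,2), of "Act t \<omega>"] show ?case
        unfolding eq unfolding st(3) D_def p_def err_def l_def .
    qed
  qed (intro Bochner_Integration.integrable_diff Bochner_Integration.integrable_add integrable_mult_right
      Bochner_Integration.integrable_sum integrable_rho integrable_rhohat integrable_err int1; assumption)+
  also have "\<dots> = real (\<tau> - t mod \<tau>) * expectation (err t) + expectation (\<lambda>\<omega>. \<Sum>s'\<in>?X. D s' \<omega> * ?P s' \<omega>)"
    using int1 by (subst Bochner_Integration.integral_add) (auto intro!: integrable_err)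
  finally show ?thesis
    using next_gap by linarith
qed

lemma gap_last:
  assumes "t mod \<tau> = \<tau> - 1"
  shows "gap t = 0"
proof -
  have "AE \<omega> in Pr. Qfun M \<tau> s0 r (rhohat (t div \<tau>) \<omega>) (S t \<omega>) (Act t \<omega>)
      - Qfun M \<tau> s0 r (rho \<omega>) (S t \<omega>) (Act t \<omega>) = 0"
    using AE_state[of t] by eventually_elim (simp add: Qfun_last assms)
  then show ?thesis
    unfolding gap_def by (rule integral_eq_zero_AE)
qed

lemma gap_le:
  assumes "k \<le> \<tau> - 1"
  shows "gap (l * \<tau> + k) \<le> (\<Sum>j=k..<\<tau>. real (\<tau> - j) * expectation (err (l * \<tau> + j)))"
  using assms
proof (induction k rule: inc_induct)
  case base
  have "gap (l * \<tau> + (\<tau> - 1)) = 0"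
    using tau by (intro gap_last, subst mod_mult_self3) simp
  then show ?case
    by (auto intro!: sum_nonneg mult_nonneg_nonneg Bochner_Integration.integral_nonneg err_nonneg)
next
  case (step k)
  have "gap (l * \<tau> + k) \<le> real (\<tau> - k) * expectation (err (l * \<tau> + k)) + gap (l * \<tau> + Suc k)"
    using gap_step[of "l * \<tau> + k"] step.hyps by simp
  then show ?case
    using step by (subst sum.atLeast_Suc_lessThan) auto
qed

text \<open>An error at step \<open>j\<close> is charged once by each of the \<open>j + 1\<close>
  starting times up to \<open>j\<close>, every time with the remaining horizon
  \<open>\<tau> - j\<close>. The two factors add up to \<open>\<tau> + 1\<close>, so their product
  is largest when they are equal.\<close>

lemma episode_weight_le:
  assumes "j < \<tau>"
  shows "real (Suc j) * real (\<tau> - j) \<le> 9 / 16 * real \<tau> ^ 2"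
proof -
  have "4 * (real (Suc j) * real (\<tau> - j)) \<le> (real (Suc j) + real (\<tau> - j))\<^sup>2"
    using sum_squares_bound[of "real (Suc j)" "real (\<tau> - j)"] by (simp add: power2_sum algebra_simps)
  also have "real (Suc j) + real (\<tau> - j) = real \<tau> + 1"
    using assms by (simp add: of_nat_diff)
  also have "(real \<tau> + 1)\<^sup>2 \<le> (3 / 2 * real \<tau>)\<^sup>2"
    using tau by (intro power_mono) auto
  finally show ?thesis by (simp add: power_mult_distrib power_divide)
qed

lemma regret_episode_le:
  "(\<Sum>t=l * \<tau>..<l * \<tau> + \<tau>. regret t) \<le> 9 / 16 * real \<tau> ^ 2 * (\<Sum>t=l * \<tau>..<l * \<tau> + \<tau>. expectation (err t))"
proof -
  let ?e = "\<lambda>j. expectation (err (l * \<tau> + j))"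
  have shift: "(\<Sum>t=l * \<tau>..<l * \<tau> + \<tau>. f t) = (\<Sum>k<\<tau>. f (l * \<tau> + k))" for f :: "nat \<Rightarrow> real"
    using sum.shift_bounds_nat_ivl[of f 0 "l * \<tau>" \<tau>] by (simp add: add.commute lessThan_atLeast0)
  have e: "0 \<le> ?e j" for j
    by (intro Bochner_Integration.integral_nonneg err_nonneg)
  have "(\<Sum>k<\<tau>. regret (l * \<tau> + k)) \<le> (\<Sum>k<\<tau>. \<Sum>j=k..<\<tau>. real (\<tau> - j) * ?e j)"
    by (intro sum_mono order_trans[OF regret_le_gap gap_le]) auto
  also have "\<dots> = (\<Sum>k<\<tau>. \<Sum>j<\<tau>. if k \<le> j then real (\<tau> - j) * ?e j else 0)"
    by (intro sum.cong refl sum.mono_neutral_cong_left) auto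
  also have "\<dots> = (\<Sum>j<\<tau>. \<Sum>k<\<tau>. if k \<le> j then real (\<tau> - j) * ?e j else 0)"
    by (rule sum.swap)
  also have "\<dots> = (\<Sum>j<\<tau>. (real (Suc j) * real (\<tau> - j)) * ?e j)"
  proof (rule sum.cong[OF refl])
    fix j assume "j \<in> {..<\<tau>}"
    then have "(\<Sum>k<\<tau>. if k \<le> j then real (\<tau> - j) * ?e j else 0) = (\<Sum>k\<le>j. real (\<tau> - j) * ?e j)"
      by (intro sum.mono_neutral_cong_right) auto
    then show "(\<Sum>k<\<tau>. if k \<le> j then real (\<tau> - j) * ?e j else 0) = (real (Suc j) * real (\<tau> - j)) * ?e j"
      by simp
  qed
  also have "\<dots> \<le> (\<Sum>j<\<tau>. 9 / 16 * real \<tau> ^ 2 * ?e j)"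
    using e episode_weight_le by (intro sum_mono mult_right_mono) auto
  finally show ?thesis
    unfolding shift by (simp add: sum_distrib_left)
qed

lemma regret_sum_le:
  "(\<Sum>t<n * \<tau>. regret t) \<le> 9 / 16 * real \<tau> ^ 2 * (\<Sum>t<n * \<tau>. expectation (err t))"
proof -
  have "(\<Sum>t<n * \<tau>. regret t) = (\<Sum>l<n. \<Sum>t=l * \<tau>..<l * \<tau> + \<tau>. regret t)"
    by (rule sum.nat_group[symmetric])
  also have "\<dots> \<le> (\<Sum>l<n. 9 / 16 * real \<tau> ^ 2 * (\<Sum>t=l * \<tau>..<l * \<tau> + \<tau>. expectation (err t)))"
    by (intro sum_mono regret_episode_le)
  also have "\<dots> = 9 / 16 * real \<tau> ^ 2 * (\<Sum>t<n * \<tau>. expectation (err t))"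
    by (simp only: sum_distrib_left[symmetric] sum.nat_group)
  finally show ?thesis .
qed

end

section \<open>Concentration of the parameters\<close>

text \<open>Counts are functions of a bare history, so that the confidence set can be one too. A
  history has one state more than actions; indexing by the actions keeps the successor state used in
  \<open>ups\<close> within range.\<close>

definition visits :: "(nat \<times> nat) list \<times> 'a list \<Rightarrow> (nat \<times> nat) \<times> 'a \<Rightarrow> nat" where
  "visits h x = (\<Sum>i<length (snd h). of_bool ((fst h ! i, snd h ! i) = x))"

definition ups :: "nat \<Rightarrow> nat \<Rightarrow> (nat \<times> nat) list \<times> 'a list \<Rightarrow> (nat \<times> nat) \<times> 'a \<Rightarrow> nat" where
  "ups M \<tau> h x = (\<Sum>i<length (snd h).
     of_bool ((fst h ! i, snd h ! i) = x \<and> fst h ! Suc i = nxt_up M \<tau> (fst x)))"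

text \<open>The confidence radius \<^term>\<open>radius c n\<close> is chosen so that the failure
  probabilities \<open>exp (- 2 n w\<^sup>2) = 1 / (c n (n + 1))\<close> telescope over the number \<open>n\<close> of visits.\<close>

definition radius :: "real \<Rightarrow> nat \<Rightarrow> real" where
  "radius c n = sqrt (ln (c * (real n * (real n + 1))) / (2 * real n))"

lemma visits_hist: "visits (hist S A t \<omega>) x = (\<Sum>i<t. of_bool ((S i \<omega>, A i \<omega>) = x))"
  unfolding visits_def hist_def histS_def histA_def
  by (auto intro!: sum.cong simp: nth_map simp del: upt_Suc)

lemma ups_hist: "ups M \<tau> (hist S A t \<omega>) x =
    (\<Sum>i<t. of_bool ((S i \<omega>, A i \<omega>) = x \<and> S (Suc i) \<omega> = nxt_up M \<tau> (fst x)))"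
  unfolding ups_def hist_def histS_def histA_def
  by (auto intro!: sum.cong simp: nth_map simp del: upt_Suc)

lemma ups_le_visits: "ups M \<tau> h x \<le> visits h x"
  unfolding ups_def visits_def by (intro sum_mono) auto

section \<open>Elementary estimates for the radii\<close>

lemma exp_radius:
  assumes "c \<ge> 1" "n \<ge> 1"
  shows "exp (- (2 * real n * (radius c n)\<^sup>2)) = 1 / (c * (real n * (real n + 1)))"
proof -
  have "1 * (1 * 1) \<le> c * (real n * (real n + 1))"
    using assms by (intro mult_mono) auto
  then have "2 * real n * (radius c n)\<^sup>2 = ln (c * (real n * (real n + 1)))"
    using assms by (simp add: radius_def)
  then show ?thesis
    using \<open>1 * (1 * 1) \<le> _\<close> by (simp add: exp_minus inverse_eq_divide)
qed

lemma radius_nonneg: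
  assumes "c \<ge> 1" "n \<ge> 1"
  shows "0 \<le> radius c n"
proof -
  have "1 * (1 * 1) \<le> c * (real n * (real n + 1))"
    using assms by (intro mult_mono) auto
  then show ?thesis by (simp add: radius_def)
qed

lemma sum_telescope_inverse: "(\<Sum>n=1..t. 1 / (real n * (real n + 1))) \<le> 1"
proof -
  have "(\<Sum>n=1..t. 1 / (real n * (real n + 1))) = 1 - 1 / (real t + 1)"
  proof (induction t)
    case (Suc t)
    have "(\<Sum>n=1..Suc t. 1 / (real n * (real n + 1))) =
        1 - 1 / (real t + 1) + 1 / ((real t + 1) * (real t + 2))"
      using Suc by (simp add: add.commute)
    also have "\<dots> = 1 - 1 / (real (Suc t) + 1)"
    proof -
      have "1 - 1 / y + 1 / (y * (y + 1)) = 1 - 1 / (y + 1)" if "y > 0" for y :: real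
      proof -
        have "y + y * y \<noteq> 0" using that by (metis add_pos_pos mult_pos_pos less_irrefl)
        with that show ?thesis by (simp add: field_simps)
      qed
      from this[of "real t + 1"] show ?thesis by (simp add: add.commute)
    qed
    finally show ?case .
  qed simp
  then show ?thesis by simp
qed

text \<open>The tangent of the concave function \<open>ln\<close> at \<open>y\<close>; it bounds the
  logarithms of \<open>n\<close> and \<open>n + 1\<close> by their values at \<open>m\<close> and
  \<open>m + 1\<close>.\<close>

lemma ln_le_ln_plus:
  fixes x y :: real
  assumes "0 < x" "0 < y"
  shows "ln x \<le> ln y + x / y - 1"
  using ln_le_minus_one[of "x / y"] assms by (simp add: ln_div)

text \<open>Up to \<open>m\<close> visits the radius decays like \<open>1 / sqrt n\<close>; beyond, its value at \<open>m\<close> suffices, because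
  \<open>ln n / n\<close> is decreasing.\<close>

lemma radius_le:
  fixes m n :: nat and c :: real
  assumes m: "m \<ge> 2" and c: "c \<ge> real m + 1" and n: "n \<ge> 1" and ln_m: "ln (real m) \<ge> 1"
  shows "2 * radius c n \<le> sqrt (6 * ln c / real n) + sqrt (6 * ln c / real m)"
proof -
  have pos: "ln c \<ge> 0" using c m by simp
  have split: "ln (c * (real n * (real n + 1))) = ln c + ln (real n) + ln (real n + 1)"
    using n c m by (simp add: ln_mult)
  have "2 * ln (c * (real n * (real n + 1))) / real n \<le> 6 * ln c / real n
      \<or> 2 * ln (c * (real n * (real n + 1))) / real n \<le> 6 * ln c / real m"
  proof (cases "n \<le> m")
    case True
    \<comment> \<open>Both \<open>n\<close> and \<open>n + 1\<close> are at most
      \<open>m + 1\<close>, hence at most \<open>c\<close>, so three logarithms are each at most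
      \<open>ln c\<close>. Doubling the radius puts 4 under the root, and 4 * 3 / 2 is the constant
      6.\<close>
    then have "ln (real n) \<le> ln c" "ln (real n + 1) \<le> ln c"
      using n c by (auto intro!: ln_mono)
    then have "ln (c * (real n * (real n + 1))) \<le> 3 * ln c"
      using split by linarith
    then have "2 * ln (c * (real n * (real n + 1))) \<le> 6 * ln c"
      by linarith
    then show ?thesis using n by (intro disjI1 divide_right_mono) auto
  next
    case False
    then have nm: "1 / real n \<le> 1 / real m" using m by (simp add: divide_simps)
    \<comment> \<open>The two summands \<open>- 1\<close> from the tangents are kept: after division
      by \<open>m\<close> they cancel exactly against the slope contribution
      \<open>2 / m\<close>.\<close>
    have "ln (real n) \<le> ln (real m) + real n / real m - 1"
      using n m by (intro ln_le_ln_plus) auto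
    moreover have "ln (real n + 1) \<le> ln (real m + 1) + (real n + 1) / (real m + 1) - 1"
      by (intro ln_le_ln_plus) auto
    moreover have "(real n + 1) / (real m + 1) \<le> real n / real m"
      using m False by (simp add: divide_simps) (simp add: algebra_simps)
    ultimately have "ln (c * (real n * (real n + 1))) \<le>
        ln c + (ln (real m) - 1) + (ln (real m + 1) - 1) + 2 * (real n / real m)"
      unfolding split by linarith
    then have "ln (c * (real n * (real n + 1))) / real n \<le>
        (ln c + (ln (real m) - 1) + (ln (real m + 1) - 1) + 2 * (real n / real m)) / real n"
      by (intro divide_right_mono) auto
    also have "\<dots> = (ln c + (ln (real m) - 1) + (ln (real m + 1) - 1)) * (1 / real n) + 2 / real m"
      using n by (simp add: add_divide_distrib)
    also have "\<dots> \<le> (ln c + (ln (real m) - 1) + (ln (real m + 1) - 1)) * (1 / real m) + 2 / real m"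
    \<comment> \<open>Passing from \<open>1 / n\<close> to \<open>1 / m\<close> needs a nonnegative
      factor; this is where \<open>ln m \<ge> 1\<close> enters.\<close>
    proof (intro add_right_mono mult_left_mono nm)
      have "ln (real m) \<le> ln (real m + 1)" using m by simp
      then show "0 \<le> ln c + (ln (real m) - 1) + (ln (real m + 1) - 1)"
        using pos ln_m by linarith
    qed
    also have "\<dots> = (ln c + ln (real m) + ln (real m + 1)) / real m"
      by (simp add: add_divide_distrib diff_divide_distrib)
    also have "\<dots> \<le> 3 * ln c / real m"
    proof (rule divide_right_mono)
      have "ln (real m) \<le> ln c" "ln (real m + 1) \<le> ln c"
        using m c by (auto intro!: ln_mono)
      then show "ln c + ln (real m) + ln (real m + 1) \<le> 3 * ln c" by linarith
    qed simp
    finally have "2 * (ln (c * (real n * (real n + 1))) / real n) \<le> 2 * (3 * ln c / real m)"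
      by (intro mult_left_mono) auto
    then have "2 * ln (c * (real n * (real n + 1))) / real n \<le> 6 * ln c / real m"
      unfolding times_divide_eq_right mult.assoc[symmetric] by simp
    then show ?thesis ..
  qed
  moreover have "2 * radius c n = sqrt (2 * ln (c * (real n * (real n + 1))) / real n)"
  proof -
    have "2 * radius c n = sqrt (4 * (ln (c * (real n * (real n + 1))) / (2 * real n)))"
      unfolding radius_def by (simp only: real_sqrt_mult) simp
    then show ?thesis by (simp add: field_simps)
  qed
  ultimately have "2 * radius c n \<le> sqrt (6 * ln c / real n) \<or> 2 * radius c n \<le> sqrt (6 * ln c / real m)"
    by (metis real_sqrt_le_mono)
  moreover have "0 \<le> sqrt (6 * ln c / real n)" "0 \<le> sqrt (6 * ln c / real m)"
    using pos by auto
  ultimately show ?thesis by linarith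
qed

lemma sum_inverse_sqrt_le: "(\<Sum>n=1..<N. 1 / sqrt (real n)) \<le> 2 * sqrt (real N)"
proof -
  have strong: "(\<Sum>n=1..<Suc k. 1 / sqrt (real n)) \<le> 2 * sqrt (real k)" for k
  proof (induction k)
    case (Suc k)
    \<comment> \<open>The AM-GM inequality yields the telescoping step:
      \<open>1 / sqrt (k + 1)\<close> is at most twice the increment of \<open>sqrt\<close> from
      \<open>k\<close> to \<open>k + 1\<close>.\<close>
    have "sqrt (real (Suc k)) * sqrt (real k) \<le> (real (Suc k) + real k) / 2"
      using arith_geo_mean_sqrt[of "real (Suc k)" "real k"] by (simp add: real_sqrt_mult)
    moreover have "sqrt (real (Suc k)) * sqrt (real (Suc k)) = real (Suc k)"
      by simp
    ultimately have "1 \<le> 2 * (sqrt (real (Suc k)) - sqrt (real k)) * sqrt (real (Suc k))"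
      by (simp add: algebra_simps del: real_sqrt_mult_self)
    then have "1 / sqrt (real (Suc k)) \<le> 2 * (sqrt (real (Suc k)) - sqrt (real k))"
      by (simp add: divide_le_eq)
    with Suc show ?case by simp
  qed simp
  show ?thesis
  proof (cases N)
    case (Suc k)
    show ?thesis
      unfolding Suc by (rule order_trans[OF strong]) simp
  qed simp
qed

lemma sum_sqrt_le:
  assumes "finite X" "\<And>x. x \<in> X \<Longrightarrow> 0 \<le> f x"
  shows "(\<Sum>x\<in>X. sqrt (f x)) \<le> sqrt (real (card X) * (\<Sum>x\<in>X. f x))"
proof (rule real_le_rsqrt)
  have "(\<Sum>x\<in>X. 1 * sqrt (f x))\<^sup>2 \<le> (\<Sum>x\<in>X. 1\<^sup>2) * (\<Sum>x\<in>X. (sqrt (f x))\<^sup>2)"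
    by (rule Cauchy_Schwarz_ineq_sum)
  then show "(\<Sum>x\<in>X. sqrt (f x))\<^sup>2 \<le> real (card X) * (\<Sum>x\<in>X. f x)"
    using assms(2) by simp
qed

section \<open>Exponential supermartingale, confidence sets and total error\<close>

context thompson_mdp
begin

abbreviation N :: "nat \<Rightarrow> (nat \<times> nat) \<times> 'a \<Rightarrow> 'w \<Rightarrow> nat" where
  "N t x \<omega> \<equiv> visits (hist S Act t \<omega>) x"

abbreviation U :: "nat \<Rightarrow> (nat \<times> nat) \<times> 'a \<Rightarrow> 'w \<Rightarrow> nat" where
  "U t x \<omega> \<equiv> ups M \<tau> (hist S Act t \<omega>) x"

lemma N_le: "N t x \<omega> \<le> t"
proof -
  have "(\<Sum>i<t. of_bool ((S i \<omega>, Act i \<omega>) = x)) \<le> (\<Sum>i<t. 1 :: nat)"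
    by (intro sum_mono) auto
  then show ?thesis by (simp add: visits_hist)
qed

text \<open>Hoeffding's compensated exponential of the centred number of up-moves from
  \<open>x\<close>. It changes only at visits of \<open>x\<close>, each of which is compensated by
  \<open>l^2 / 8\<close>, the bound of \<open>bernoulli_mgf_le\<close>.\<close>

definition Z :: "real \<Rightarrow> nat \<Rightarrow> (nat \<times> nat) \<times> 'a \<Rightarrow> 'w \<Rightarrow> real" where
  "Z l t x \<omega> = exp (l * (real (U t x \<omega>) - real (N t x \<omega>) * rho \<omega> x) - l\<^sup>2 / 8 * real (N t x \<omega>))"

lemma measurable_Z: "Z l t x \<in> borel_measurable (G t)"
proof -
  have "(\<lambda>\<omega>. exp (l * (real (ups M \<tau> h x) - real (visits h x) * rho \<omega> x) - l\<^sup>2 / 8 * real (visits h x)))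
      \<in> borel_measurable (G t)" for h
    using measurable_Theta_component[OF measurable_G_rho] by auto
  then show ?thesis
    unfolding Z_def using measurable_G_hist by (rule measurable_compose_countable)
qed

lemma Z_bound:
  assumes "0 \<le> rho \<omega> x" "rho \<omega> x \<le> 1"
  shows "0 \<le> Z l t x \<omega>" "Z l t x \<omega> \<le> exp (\<bar>l\<bar> * real t)"
proof -
  let ?d = "real (U t x \<omega>) - real (N t x \<omega>) * rho \<omega> x"
  have "0 \<le> real (N t x \<omega>) * rho \<omega> x" "real (N t x \<omega>) * rho \<omega> x \<le> real (N t x \<omega>)"
    using assms by (auto simp: mult_left_le)
  moreover have "real (U t x \<omega>) \<le> real (N t x \<omega>)" "real (N t x \<omega>) \<le> real t"
    using ups_le_visits[of M \<tau> "hist S Act t \<omega>" x] N_le[of t \<omega> x] by auto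
  ultimately have "\<bar>?d\<bar> \<le> real t" by linarith
  have "l * ?d \<le> \<bar>l * ?d\<bar>" by (rule abs_ge_self)
  also have "\<dots> \<le> \<bar>l\<bar> * real t"
    unfolding abs_mult using \<open>\<bar>?d\<bar> \<le> real t\<close> by (rule mult_left_mono) simp
  finally have "l * ?d - l\<^sup>2 / 8 * real (N t x \<omega>) \<le> \<bar>l\<bar> * real t"
    by (smt (verit) mult_nonneg_nonneg of_nat_0_le_iff zero_le_power2 divide_nonneg_nonneg)
  then show "Z l t x \<omega> \<le> exp (\<bar>l\<bar> * real t)"
    unfolding Z_def by simp
  show "0 \<le> Z l t x \<omega>" by (simp add: Z_def)
qed

lemma AE_rho_bounds:
  assumes "x \<in> paramidx M \<tau>"
  shows "AE \<omega> in Pr. 0 \<le> rho \<omega> x \<and> rho \<omega> x \<le> 1"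
  using AE_param by eventually_elim (use assms in \<open>auto simp: valid_param_def\<close>)

lemma integrable_Z:
  assumes "x \<in> paramidx M \<tau>"
  shows "integrable Pr (Z l t x)"
proof (rule integrable_bounded[OF measurable_from_subalg[OF subalgebra_G measurable_Z]])
  show "AE \<omega> in Pr. \<bar>Z l t x \<omega>\<bar> \<le> exp (\<bar>l\<bar> * real t)"
    using AE_rho_bounds[OF assms] by eventually_elim (use Z_bound in auto)
qed

text \<open>A visit multiplies \<open>Z\<close> by \<open>c1\<close> after an up-move and by
  \<open>c0\<close> otherwise. Hence the new value is \<open>B + W * ?J\<close>, where
  \<open>B\<close> and \<open>W\<close> are known before the transition and only the indicator
  \<open>?J\<close> of the up-state is new; the dynamics replace it by its probability, and
  Hoeffding's lemma bounds the averaged factor by 1.\<close>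

lemma expectation_Z_Suc:
  assumes x: "x \<in> informative"
  shows "expectation (Z l (Suc t) x) \<le> expectation (Z l t x)"
proof -
  have idx: "x \<in> paramidx M \<tau>" and ud: "nxt_up M \<tau> (fst x) \<noteq> nxt_down M \<tau> (fst x)"
    using x by (auto simp: informative_def)
  define I where "I \<omega> = (of_bool ((S t \<omega>, Act t \<omega>) = x) :: real)" for \<omega>
  define c0 where "c0 \<omega> = exp (- (l * rho \<omega> x) - l\<^sup>2 / 8)" for \<omega>
  define c1 where "c1 \<omega> = exp (l * (1 - rho \<omega> x) - l\<^sup>2 / 8)" for \<omega>
  define W where "W \<omega> = Z l t x \<omega> * I \<omega> * (c1 \<omega> - c0 \<omega>)" for \<omega>
  define B where "B \<omega> = Z l t x \<omega> * (1 - I \<omega>) + Z l t x \<omega> * I \<omega> * c0 \<omega>" for \<omega>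
  let ?J = "\<lambda>\<omega>. indicator {nxt_up M \<tau> (fst x)} (S (Suc t) \<omega>) :: real"
  let ?P = "\<lambda>\<omega>. transP M \<tau> s0 (rho \<omega>) (S t \<omega>) (Act t \<omega>) (nxt_up M \<tau> (fst x))"
  note [measurable] = measurable_Theta_component[OF measurable_G_rho, of x t] measurable_Z
  have [measurable]: "I \<in> borel_measurable (G t)"
  proof -
    have "(\<lambda>\<omega>. (S t \<omega>, Act t \<omega>)) \<in> measurable (G t) (count_space UNIV)"
      by (intro measurable_Pair_countable measurable_G_S measurable_G_Act) auto
    from measurable_compose[OF this, of "\<lambda>y. of_bool (y = x) :: real" borel]
    show ?thesis by (simp add: I_def[abs_def])
  qed
  have W: "W \<in> borel_measurable (G t)" and B: "B \<in> borel_measurable (G t)"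
    unfolding W_def[abs_def] B_def[abs_def] c0_def c1_def by measurable
  have c: "\<bar>c1 \<omega> - c0 \<omega>\<bar> \<le> exp \<bar>l\<bar>" "c0 \<omega> \<le> exp \<bar>l\<bar>" "0 \<le> c0 \<omega>"
    if "0 \<le> rho \<omega> x" "rho \<omega> x \<le> 1" for \<omega>
  proof -
    have "\<bar>l * rho \<omega> x\<bar> \<le> \<bar>l\<bar>" "\<bar>l * (1 - rho \<omega> x)\<bar> \<le> \<bar>l\<bar>"
      using that by (auto simp: abs_mult mult_left_le)
    moreover have "0 \<le> l\<^sup>2 / 8" by simp
    ultimately have "- (l * rho \<omega> x) - l\<^sup>2 / 8 \<le> \<bar>l\<bar>" "l * (1 - rho \<omega> x) - l\<^sup>2 / 8 \<le> \<bar>l\<bar>"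
      by linarith+
    then have "c0 \<omega> \<le> exp \<bar>l\<bar>" "c1 \<omega> \<le> exp \<bar>l\<bar>"
      unfolding c0_def c1_def by auto
    moreover have "0 \<le> c0 \<omega>" "0 \<le> c1 \<omega>"
      by (auto simp: c0_def c1_def)
    ultimately show "\<bar>c1 \<omega> - c0 \<omega>\<bar> \<le> exp \<bar>l\<bar>" "c0 \<omega> \<le> exp \<bar>l\<bar>" "0 \<le> c0 \<omega>" by linarith+
  qed
  have W_bound: "AE \<omega> in Pr. \<bar>W \<omega>\<bar> \<le> exp (\<bar>l\<bar> * real t) * exp \<bar>l\<bar>"
    using AE_rho_bounds[OF idx]
  proof eventually_elim
    case (elim \<omega>)
    then have "\<bar>Z l t x \<omega> * I \<omega>\<bar> * \<bar>c1 \<omega> - c0 \<omega>\<bar> \<le> exp (\<bar>l\<bar> * real t) * exp \<bar>l\<bar>"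
      using c[of \<omega>] Z_bound[of \<omega> x l t] by (intro mult_mono) (auto simp: I_def)
    then show ?case by (simp add: W_def abs_mult)
  qed
  have B_bound: "AE \<omega> in Pr. \<bar>B \<omega>\<bar> \<le> exp (\<bar>l\<bar> * real t) * exp \<bar>l\<bar>"
    using AE_rho_bounds[OF idx]
  proof eventually_elim
    case (elim \<omega>)
    then have "Z l t x \<omega> * c0 \<omega> \<le> exp (\<bar>l\<bar> * real t) * exp \<bar>l\<bar>" "Z l t x \<omega> * 1 \<le> exp (\<bar>l\<bar> * real t) * exp \<bar>l\<bar>"
      using c[of \<omega>] Z_bound[of \<omega> x l t] by (intro mult_mono; simp)+
    then show ?case using c[of \<omega>] Z_bound[of \<omega> x l t] elim by (simp add: B_def I_def)
  qed
  have intB: "integrable Pr B"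
    by (rule integrable_bounded[OF measurable_from_subalg[OF subalgebra_G B] B_bound])
  have intWP: "integrable Pr (\<lambda>\<omega>. W \<omega> * ?P \<omega>)"
    by (rule integrable_step[OF W W_bound])
  have intWJ: "integrable Pr (\<lambda>\<omega>. W \<omega> * ?J \<omega>)"
  proof (rule integrable_bounded)
    show "(\<lambda>\<omega>. W \<omega> * ?J \<omega>) \<in> borel_measurable Pr"
      using measurable_from_subalg[OF subalgebra_G W]
        measurable_compose[OF meas_S[of "Suc t"], of "indicator {nxt_up M \<tau> (fst x)} :: _ \<Rightarrow> real" borel] by auto
    show "AE \<omega> in Pr. \<bar>W \<omega> * ?J \<omega>\<bar> \<le> exp (\<bar>l\<bar> * real t) * exp \<bar>l\<bar>"
      using W_bound by eventually_elim (auto simp: indicator_def)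
  qed
  have "Z l (Suc t) x = (\<lambda>\<omega>. B \<omega> + W \<omega> * ?J \<omega>)"
  proof
    fix \<omega>
    show "Z l (Suc t) x \<omega> = B \<omega> + W \<omega> * ?J \<omega>"
      by (auto simp: Z_def B_def W_def I_def c0_def c1_def visits_hist ups_hist indicator_def
          simp flip: exp_add intro!: arg_cong[where f = exp])
        (auto simp: algebra_simps exp_add[symmetric] add_divide_distrib)
  qed
  then have "expectation (Z l (Suc t) x) = expectation B + expectation (\<lambda>\<omega>. W \<omega> * ?J \<omega>)"
    using intB intWJ by simp
  also have "\<dots> = expectation B + expectation (\<lambda>\<omega>. W \<omega> * ?P \<omega>)"
    using expectation_step[OF W W_bound] by simp
  also have "\<dots> = expectation (\<lambda>\<omega>. B \<omega> + W \<omega> * ?P \<omega>)"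
    using intB intWP by simp
  also have "\<dots> \<le> expectation (Z l t x)"
  proof (rule integral_mono_AE)
    show "AE \<omega> in Pr. B \<omega> + W \<omega> * ?P \<omega> \<le> Z l t x \<omega>"
      using AE_rho_bounds[OF idx]
    proof eventually_elim
      case (elim \<omega>)
      show ?case
      proof (cases "(S t \<omega>, Act t \<omega>) = x")
        case True
        \<comment> \<open>Distinct successors are essential: if they coincided, this transition
          probability would be 1 whatever the parameter.\<close>
        then have "?P \<omega> = rho \<omega> x"
          using idx ud by (cases x) (auto simp: transP_def paramidx_iff)
        then have eq: "B \<omega> + W \<omega> * ?P \<omega> = Z l t x \<omega> * (c0 \<omega> * (1 - rho \<omega> x) + c1 \<omega> * rho \<omega> x)"
          using True by (simp add: B_def W_def I_def algebra_simps)
        have "c0 \<omega> * (1 - rho \<omega> x) + c1 \<omega> * rho \<omega> x =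
            (exp (- (l * rho \<omega> x)) * (1 - rho \<omega> x) + exp (l * (1 - rho \<omega> x)) * rho \<omega> x) / exp (l\<^sup>2 / 8)"
          by (simp add: c0_def c1_def exp_diff add_divide_distrib)
        also have "\<dots> \<le> 1"
          using bernoulli_mgf_le[of "rho \<omega> x" l] elim by simp
        finally have "Z l t x \<omega> * (c0 \<omega> * (1 - rho \<omega> x) + c1 \<omega> * rho \<omega> x) \<le> Z l t x \<omega> * 1"
          using Z_bound(1)[of \<omega> x l t] elim by (intro mult_left_mono) auto
        then show ?thesis unfolding eq by simp
      qed (simp add: B_def W_def I_def)
    qed
  qed (use intB intWP integrable_Z[OF idx] in auto)
  finally show ?thesis .
qed

lemma expectation_Z: "x \<in> informative \<Longrightarrow> expectation (Z l t x) \<le> 1"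
proof (induction t)
  case 0
  have "Z l 0 x = (\<lambda>_. 1)" by (simp add: Z_def[abs_def] visits_hist ups_hist)
  then show ?case by (simp add: prob_space)
next
  case (Suc t)
  then show ?case using expectation_Z_Suc[of x l t] by simp
qed

lemma deviation_prob:
  assumes x: "x \<in> informative" and w: "0 \<le> w" and sg: "sg\<^sup>2 = (1 :: real)"
  shows "prob {\<omega> \<in> space Pr. N t x \<omega> = n \<and> real n * w \<le> sg * (real (U t x \<omega>) - real n * rho \<omega> x)}
    \<le> exp (- (2 * real n * w\<^sup>2))" (is "prob ?E \<le> _")
proof -
  have idx: "x \<in> paramidx M \<tau>" using x by (simp add: informative_def)
  \<comment> \<open>The choice \<open>4 * w\<close> maximises
    \<open>l * n * w - l^2 / 8 * n\<close>, with maximum \<open>2 * n * w^2\<close>;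
    \<open>sg\<close> selects the upper or the lower tail.\<close>
  define l where "l = 4 * w * sg"
  let ?c = "exp (2 * real n * w\<^sup>2)"
  have "?E \<subseteq> {\<omega> \<in> space Pr. ?c \<le> Z l t x \<omega>}"
  proof safe
    fix \<omega> assume n: "n = N t x \<omega>" and d: "real (N t x \<omega>) * w \<le> sg * (real (U t x \<omega>) - real (N t x \<omega>) * rho \<omega> x)"
    have "4 * w * (real n * w) \<le> 4 * w * (sg * (real (U t x \<omega>) - real n * rho \<omega> x))"
      using d w n by (intro mult_left_mono) auto
    moreover have "4 * w * (real n * w) = 4 * (real n * w\<^sup>2)"
      by (simp add: power2_eq_square)
    moreover have "4 * w * (sg * (real (U t x \<omega>) - real n * rho \<omega> x)) = l * (real (U t x \<omega>) - real n * rho \<omega> x)"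
      by (simp add: l_def)
    moreover have "l\<^sup>2 / 8 * real n = 2 * real n * w\<^sup>2"
      using sg by (simp add: l_def power_mult_distrib)
    ultimately have "2 * real n * w\<^sup>2 \<le> l * (real (U t x \<omega>) - real n * rho \<omega> x) - l\<^sup>2 / 8 * real n"
      by linarith
    then show "exp (2 * real (N t x \<omega>) * w\<^sup>2) \<le> Z l t x \<omega>"
      using n by (simp add: Z_def)
  qed
  moreover have "{\<omega> \<in> space Pr. ?c \<le> Z l t x \<omega>} \<in> sets Pr"
    using measurable_from_subalg[OF subalgebra_G measurable_Z] by measurable
  ultimately have "prob ?E \<le> prob {\<omega> \<in> space Pr. ?c \<le> Z l t x \<omega>}"
    by (intro finite_measure_mono)
  also have "\<dots> \<le> expectation (Z l t x) / ?c"
    by (rule integral_Markov_inequality_measure[OF integrable_Z[OF idx], of "{}"]) (auto simp: Z_def)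
  also have "\<dots> \<le> 1 / ?c"
    using expectation_Z[OF x] by (intro divide_right_mono) auto
  finally show ?thesis by (simp add: exp_minus inverse_eq_divide)
qed

text \<open>The complement of the confidence set. Deviations are multiplied by the number of visits
  to avoid dividing; a pair not yet visited imposes no constraint.\<close>

definition bad :: "real \<Rightarrow> (nat \<times> nat) list \<times> 'a list \<Rightarrow> ((nat \<times> nat) \<times> 'a \<Rightarrow> real) set" where
  "bad c h = {p \<in> space (Theta M \<tau>). \<exists>x\<in>informative. visits h x \<ge> 1 \<and>
     real (visits h x) * radius c (visits h x) \<le> \<bar>real (ups M \<tau> h x) - real (visits h x) * p x\<bar>}"

lemma sets_bad: "bad c h \<in> sets (Theta M \<tau>)"
proof -
  have [measurable]: "(\<lambda>p. p x) \<in> borel_measurable (Theta M \<tau>)" for x :: "(nat \<times> nat) \<times> 'a"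
    by (rule measurable_Theta_component[where M = M and \<tau> = \<tau>]) simp
  show ?thesis
    unfolding bad_def by (intro sets.sets_Collect_finite_Ex finite_informative) measurable
qed

text \<open>The visit count at time \<open>t\<close> is random, so the union runs over all its
  possible values, besides pairs and signs. The telescoping failure probabilities make the bound
  independent of \<open>t\<close>.\<close>

lemma prob_bad_rho:
  assumes c: "c \<ge> 1"
  shows "prob {\<omega> \<in> space Pr. rho \<omega> \<in> bad c (hist S Act t \<omega>)} \<le> 2 * real (card informative) / c"
proof -
  let ?I = "informative \<times> {1..t} \<times> {1, -1 :: real}"
  define E where "E i = (case i of (x, n, sg) \<Rightarrow>
    {\<omega> \<in> space Pr. N t x \<omega> = n \<and> real n * radius c n \<le> sg * (real (U t x \<omega>) - real n * rho \<omega> x)})" for i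
  have E_sets: "E i \<in> sets Pr" for i
  proof -
    obtain x n sg where i: "i = (x, n, sg)" by (cases i)
    have "Measurable.pred Pr (\<lambda>\<omega>. visits h x = n \<and> real n * radius c n \<le> sg * (real (ups M \<tau> h x) - real n * rho \<omega> x))" for h
      using measurable_Theta_component[OF meas_rho] by measurable
    then have "Measurable.pred Pr (\<lambda>\<omega>. N t x \<omega> = n \<and> real n * radius c n \<le> sg * (real (U t x \<omega>) - real n * rho \<omega> x))"
      using measurable_hist by (rule measurable_compose_countable)
    then show ?thesis by (simp add: E_def i pred_def)
  qed
  have "{\<omega> \<in> space Pr. rho \<omega> \<in> bad c (hist S Act t \<omega>)} \<subseteq> (\<Union>i\<in>?I. E i)"
  proof
    fix \<omega> assume "\<omega> \<in> {\<omega> \<in> space Pr. rho \<omega> \<in> bad c (hist S Act t \<omega>)}"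
    then obtain x where x: "\<omega> \<in> space Pr" "x \<in> informative" "N t x \<omega> \<ge> 1"
      "real (N t x \<omega>) * radius c (N t x \<omega>) \<le> \<bar>real (U t x \<omega>) - real (N t x \<omega>) * rho \<omega> x\<bar>"
      by (auto simp: bad_def)
    define sg where "sg = (if real (U t x \<omega>) - real (N t x \<omega>) * rho \<omega> x \<ge> 0 then 1 else -1 :: real)"
    have "(x, N t x \<omega>, sg) \<in> ?I" "\<omega> \<in> E (x, N t x \<omega>, sg)"
      using x N_le[of t \<omega> x] by (auto simp: E_def sg_def)
    then show "\<omega> \<in> (\<Union>i\<in>?I. E i)" by blast
  qed
  then have "prob {\<omega> \<in> space Pr. rho \<omega> \<in> bad c (hist S Act t \<omega>)} \<le> prob (\<Union>i\<in>?I. E i)"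
    using finite_informative by (intro finite_measure_mono sets.finite_UN E_sets) auto
  also have "\<dots> \<le> (\<Sum>i\<in>?I. prob (E i))"
    using finite_informative E_sets by (intro finite_measure_subadditive_finite) auto
  also have "\<dots> \<le> (\<Sum>(x, n, sg)\<in>?I. 1 / c * (1 / (real n * (real n + 1))))"
  proof (rule sum_mono)
    fix i assume "i \<in> ?I"
    then obtain x n sg where i: "i = (x, n, sg)" "x \<in> informative" "n \<ge> 1" "sg = 1 \<or> sg = -1"
      by auto
    have "prob (E i) \<le> exp (- (2 * real n * (radius c n)\<^sup>2))"
      unfolding i(1) E_def prod.case using i c by (intro deviation_prob radius_nonneg) auto
    then show "prob (E i) \<le> (case i of (x, n, sg) \<Rightarrow> 1 / c * (1 / (real n * (real n + 1))))"
      using i c by (simp add: exp_radius)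
  qed
  also have "\<dots> = 2 * real (card informative) / c * (\<Sum>n=1..t. 1 / (real n * (real n + 1)))"
    by (simp add: sum.cartesian_product[symmetric] sum_distrib_left mult.commute)
  also have "\<dots> \<le> 2 * real (card informative) / c * 1"
    using c by (intro mult_left_mono sum_telescope_inverse) auto
  finally show ?thesis by simp
qed

text \<open>The history is taken at an episode start, where the sample and the parameter can be
  exchanged.\<close>

lemma prob_bad_rhohat:
  assumes "c \<ge> 1"
  shows "prob {\<omega> \<in> space Pr. rhohat l \<omega> \<in> bad c (hist S Act (l * \<tau>) \<omega>)} \<le> 2 * real (card informative) / c"
  using prob_bad_rho[OF assms, of "l * \<tau>"] posterior_sampling[of "bad c" l, OF sets_bad] by simp

text \<open>The factor 2 is one radius each for the parameter and the sample. At
  \<open>n = 0\<close> division by zero would make \<open>radius\<close> zero, so the trivial error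
  bound 1 is charged instead.\<close>

definition bonus :: "real \<Rightarrow> nat \<Rightarrow> real" where
  "bonus c n = (if n = 0 then 1 else 2 * radius c n)"

lemma AE_visits_episode:
  "AE \<omega> in Pr. N (t div \<tau> * \<tau>) (S t \<omega>, a) \<omega> = N t (S t \<omega>, a) \<omega>"
  using AE_good
proof eventually_elim
  case (elim \<omega>)
  have neq: "S i \<omega> \<noteq> S t \<omega>" if "t div \<tau> * \<tau> \<le> i" "i < t" for i
  proof -
    have "i mod \<tau> \<noteq> t mod \<tau>"
    proof
      assume "i mod \<tau> = t mod \<tau>"
      moreover have "i div \<tau> = t div \<tau>"
      proof (rule antisym)
        show "i div \<tau> \<le> t div \<tau>" using that by (intro div_le_mono) simp
        show "t div \<tau> \<le> i div \<tau>" using that tau by (simp add: less_eq_div_iff_mult_less_eq)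
      qed
      ultimately have "i = t" by (metis div_mult_mod_eq)
      with that show False by simp
    qed
    with elim show ?thesis by metis
  qed
  show ?case
    unfolding visits_hist
  proof (rule sum.mono_neutral_left)
    show "{..<t div \<tau> * \<tau>} \<subseteq> {..<t}"
      using div_times_less_eq_dividend[of t \<tau>] by auto
    show "\<forall>i\<in>{..<t} - {..<t div \<tau> * \<tau>}. of_bool ((S i \<omega>, Act i \<omega>) = (S t \<omega>, a)) = (0 :: nat)"
      using neq by (auto simp: not_less)
  qed simp
qed

text \<open>If either parameter is bad, one indicator already covers the trivial bound 1. Otherwise
  both lie within one radius of the same empirical frequency, and the triangle inequality
  applies.\<close>

lemma err_le:
  "AE \<omega> in Pr. err t \<omega> \<le> indicator {\<omega> \<in> space Pr. rho \<omega> \<in> bad c (hist S Act (t div \<tau> * \<tau>) \<omega>)} \<omega>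
      + indicator {\<omega> \<in> space Pr. rhohat (t div \<tau>) \<omega> \<in> bad c (hist S Act (t div \<tau> * \<tau>) \<omega>)} \<omega>
      + of_bool ((S t \<omega>, Act t \<omega>) \<in> informative) * bonus c (N t (S t \<omega>, Act t \<omega>) \<omega>)"
    (is "AE \<omega> in Pr. _ \<le> ?i1 \<omega> + ?i2 \<omega> + ?b \<omega>")
  if c: "c \<ge> 1"
proof -
  have "AE \<omega> in Pr. \<forall>a. N (t div \<tau> * \<tau>) (S t \<omega>, a) \<omega> = N t (S t \<omega>, a) \<omega>"
    using AE_visits_episode by (subst AE_all_countable) auto
  then show ?thesis
    using err_le_1[of t] AE_space
  proof eventually_elim
    case (elim \<omega>)
    let ?x = "(S t \<omega>, Act t \<omega>)" and ?h = "hist S Act (t div \<tau> * \<tau>) \<omega>"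
    have b: "0 \<le> ?b \<omega>"
      using radius_nonneg[OF c] by (auto simp: bonus_def)
    show ?case
    proof (cases "rho \<omega> \<in> bad c ?h \<or> rhohat (t div \<tau>) \<omega> \<in> bad c ?h")
      case True
      then have "1 \<le> ?i1 \<omega> + ?i2 \<omega>"
        using elim by (auto simp: indicator_def)
      with elim b show ?thesis by linarith
    next
      case False
      have "err t \<omega> \<le> ?b \<omega>"
      proof (cases "?x \<in> informative \<and> N t ?x \<omega> \<noteq> 0")
        case True
        let ?n = "visits ?h ?x"
        have n: "?n = N t ?x \<omega>" "?n \<ge> 1" using True elim by auto
        have close: "\<bar>real (ups M \<tau> ?h ?x) - real ?n * p ?x\<bar> < real ?n * radius c ?n"
          if "p \<notin> bad c ?h" "p \<in> space (Theta M \<tau>)" for p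
        proof (rule ccontr)
          assume "\<not> ?thesis"
          then have "p \<in> bad c ?h"
            using that True n(2) unfolding bad_def by (auto simp: not_less)
          with that show False by simp
        qed
        have "\<bar>real ?n * (rhohat (t div \<tau>) \<omega> ?x - rho \<omega> ?x)\<bar> \<le> real ?n * (2 * radius c ?n)"
          using close[of "rho \<omega>"] close[of "rhohat (t div \<tau>) \<omega>"] False
            measurable_space[OF meas_rho] measurable_space[OF meas_rhohat] elim
          by (simp add: algebra_simps)
        then have "\<bar>rhohat (t div \<tau>) \<omega> ?x - rho \<omega> ?x\<bar> \<le> 2 * radius c ?n"
          using n(2) by (simp add: abs_mult)
        then show ?thesis
          using True n by (simp add: err_def bonus_def)
      next
        case False
        then show ?thesis using elim by (auto simp: err_def bonus_def)
      qed
      moreover have "0 \<le> ?i1 \<omega>" "0 \<le> ?i2 \<omega>" by auto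
      ultimately show ?thesis by linarith
    qed
  qed
qed

text \<open>Successive visits to a pair see the running counts 0, 1, 2, ..., so regrouping time by
  pairs makes the inner sums deterministic functions of the final counts.\<close>

lemma sum_bonus:
  "(\<Sum>i<t. of_bool ((S i \<omega>, Act i \<omega>) \<in> informative) * bonus c (N i (S i \<omega>, Act i \<omega>) \<omega>)) =
    (\<Sum>x\<in>informative. \<Sum>n<N t x \<omega>. bonus c n)"
proof (induction t)
  case (Suc t)
  let ?x = "(S t \<omega>, Act t \<omega>)"
  have N_Suc: "N (Suc t) x \<omega> = N t x \<omega> + of_bool (x = ?x)" for x
    by (auto simp: visits_hist)
  have "(\<Sum>x\<in>informative. \<Sum>n<N (Suc t) x \<omega>. bonus c n) =
      (\<Sum>x\<in>informative. (\<Sum>n<N t x \<omega>. bonus c n) + (if x = ?x then bonus c (N t ?x \<omega>) else 0))"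
    unfolding N_Suc by (intro sum.cong) auto
  also have "\<dots> = (\<Sum>x\<in>informative. \<Sum>n<N t x \<omega>. bonus c n)
      + of_bool (?x \<in> informative) * bonus c (N t ?x \<omega>)"
    by (simp add: sum.distrib sum.delta finite_informative)
  finally show ?case using Suc by simp
qed (simp add: visits_hist)

lemma sum_N_le: "(\<Sum>x\<in>informative. N t x \<omega>) \<le> t"
proof -
  have "(\<Sum>x\<in>informative. N t x \<omega>) = (\<Sum>i<t. \<Sum>x\<in>informative. of_bool ((S i \<omega>, Act i \<omega>) = x))"
    unfolding visits_hist by (rule sum.swap)
  also have "\<dots> \<le> (\<Sum>i<t. 1)"
    by (intro sum_mono) (simp add: finite_informative of_bool_def sum.delta' sum.delta)
  finally show ?thesis by simp
qed

text \<open>For each pair, the first visit costs 1, the later ones a sum of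
  \<open>1 / sqrt n\<close> plus a constant per visit from the second term of
  \<open>radius_le\<close>. Cauchy-Schwarz over the pairs, whose visits total at most
  \<open>t\<close>, gives the square-root term.\<close>

lemma sum_bonus_le:
  fixes m :: nat and c K :: real
  assumes m: "m \<ge> 2" "ln (real m) \<ge> 1" and c: "c \<ge> real m + 1" and K: "real (card informative) \<le> K"
  shows "(\<Sum>x\<in>informative. \<Sum>n<N t x \<omega>. bonus c n) \<le>
    K + 2 * sqrt (6 * ln c) * sqrt (K * real t) + real t * sqrt (6 * ln c / real m)"
proof -
  have pos: "0 \<le> ln c" using c m by simp
  have one: "(\<Sum>n<k. bonus c n) \<le> 1 + 2 * sqrt (6 * ln c) * sqrt (real k) + real k * sqrt (6 * ln c / real m)" for k
  proof (cases "k = 0")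
    case False
    have "(\<Sum>n<k. bonus c n) = 1 + (\<Sum>n=1..<k. 2 * radius c n)"
      using False by (subst lessThan_atLeast0, subst sum.atLeast_Suc_lessThan) (auto simp: bonus_def intro!: sum.cong)
    also have "(\<Sum>n=1..<k. 2 * radius c n) \<le> (\<Sum>n=1..<k. sqrt (6 * ln c) * (1 / sqrt (real n)) + sqrt (6 * ln c / real m))"
      using radius_le[OF m(1) c _ m(2)] by (intro sum_mono) (simp add: real_sqrt_divide)
    also have "\<dots> = sqrt (6 * ln c) * (\<Sum>n=1..<k. 1 / sqrt (real n)) + real (k - 1) * sqrt (6 * ln c / real m)"
      by (simp add: sum.distrib sum_distrib_left)
    also have "\<dots> \<le> sqrt (6 * ln c) * (2 * sqrt (real k)) + real k * sqrt (6 * ln c / real m)"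
      using pos by (intro add_mono mult_left_mono mult_right_mono sum_inverse_sqrt_le) auto
    finally show ?thesis by simp
  qed simp
  have N: "(\<Sum>x\<in>informative. real (N t x \<omega>)) \<le> real t"
    using sum_N_le[of t \<omega>] by (simp flip: of_nat_sum)
  have "(\<Sum>x\<in>informative. \<Sum>n<N t x \<omega>. bonus c n) \<le>
      (\<Sum>x\<in>informative. 1 + 2 * sqrt (6 * ln c) * sqrt (real (N t x \<omega>)) + real (N t x \<omega>) * sqrt (6 * ln c / real m))"
    by (intro sum_mono one)
  also have "\<dots> = real (card informative) + 2 * sqrt (6 * ln c) * (\<Sum>x\<in>informative. sqrt (real (N t x \<omega>)))
      + (\<Sum>x\<in>informative. real (N t x \<omega>)) * sqrt (6 * ln c / real m)"
    by (simp add: sum.distrib sum_distrib_left sum_distrib_right)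
  also have "\<dots> \<le> K + 2 * sqrt (6 * ln c) * sqrt (K * real t) + real t * sqrt (6 * ln c / real m)"
  proof (intro add_mono mult_left_mono mult_right_mono K N)
    have "(\<Sum>x\<in>informative. sqrt (real (N t x \<omega>))) \<le> sqrt (real (card informative) * (\<Sum>x\<in>informative. real (N t x \<omega>)))"
      by (intro sum_sqrt_le finite_informative) auto
    also have "\<dots> \<le> sqrt (K * real t)"
      using K N by (intro real_sqrt_le_mono mult_mono sum_nonneg) auto
    finally show "(\<Sum>x\<in>informative. sqrt (real (N t x \<omega>))) \<le> sqrt (K * real t)" .
  qed (use pos in auto)
  finally show ?thesis .
qed

lemma sum_err_le:
  fixes m :: nat and K :: real
  assumes m: "m \<ge> 2" "ln (real m) \<ge> 1" and K: "real (card informative) \<le> K" "K \<ge> 1"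
  defines "c \<equiv> 2 * K * real m"
  shows "(\<Sum>t<n. expectation (err t)) \<le>
    real n * (2 / real m) + (K + 2 * sqrt (6 * ln c) * sqrt (K * real n) + real n * sqrt (6 * ln c / real m))"
proof -
  have "2 * 1 * real m \<le> c"
    unfolding c_def using K by (intro mult_mono) auto
  then have c: "c \<ge> real m + 1" "c \<ge> 1" using m by auto
  define i1 where "i1 t = {\<omega> \<in> space Pr. rho \<omega> \<in> bad c (hist S Act (t div \<tau> * \<tau>) \<omega>)}" for t
  define i2 where "i2 t = {\<omega> \<in> space Pr. rhohat (t div \<tau>) \<omega> \<in> bad c (hist S Act (t div \<tau> * \<tau>) \<omega>)}" for t
  have sets: "{\<omega> \<in> space Pr. f \<omega> \<in> bad c (hist S Act t \<omega>)} \<in> sets Pr"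
    if "f \<in> measurable Pr (Theta M \<tau>)" for f t
  proof -
    have "Measurable.pred Pr (\<lambda>\<omega>. f \<omega> \<in> bad c h)" for h
      using that sets_bad[of c h] by measurable
    then have "Measurable.pred Pr (\<lambda>\<omega>. f \<omega> \<in> bad c (hist S Act t \<omega>))"
      using measurable_hist by (rule measurable_compose_countable)
    then show ?thesis by (simp add: pred_def)
  qed
  have i_sets: "i1 t \<in> sets Pr" "i2 t \<in> sets Pr" for t
    unfolding i1_def i2_def by (intro sets meas_rho meas_rhohat)+
  \<comment> \<open>With \<open>c = 2 * K * m\<close> each of the two bad events has probability at
    most \<open>1 / m\<close>, and \<open>ln c\<close> is the second logarithm of the final
    bound.\<close>
  have fail: "2 * real (card informative) / c \<le> 1 / real m"
    using K m by (simp add: c_def divide_simps)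
  have i: "prob (i1 t) \<le> 1 / real m" "prob (i2 t) \<le> 1 / real m" for t
    unfolding i1_def i2_def
    using prob_bad_rho[OF c(2), of "t div \<tau> * \<tau>"] prob_bad_rhohat[OF c(2), of "t div \<tau>"] fail by auto
  let ?b = "\<lambda>t \<omega>. of_bool ((S t \<omega>, Act t \<omega>) \<in> informative) * bonus c (N t (S t \<omega>, Act t \<omega>) \<omega>)"
  let ?B = "K + 2 * sqrt (6 * ln c) * sqrt (K * real n) + real n * sqrt (6 * ln c / real m)"
  have "(\<Sum>t<n. expectation (err t)) = expectation (\<lambda>\<omega>. \<Sum>t<n. err t \<omega>)"
    by (rule Bochner_Integration.integral_sum[symmetric]) (rule integrable_err)
  also have "\<dots> \<le> expectation (\<lambda>\<omega>. (\<Sum>t<n. indicator (i1 t) \<omega> + indicator (i2 t) \<omega>) + ?B)"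
  proof (rule integral_mono_AE)
    have "AE \<omega> in Pr. \<forall>t. err t \<omega> \<le> indicator (i1 t) \<omega> + indicator (i2 t) \<omega> + ?b t \<omega>"
      unfolding i1_def i2_def using err_le[OF c(2)] by (subst AE_all_countable) auto
    then show "AE \<omega> in Pr. (\<Sum>t<n. err t \<omega>) \<le> (\<Sum>t<n. indicator (i1 t) \<omega> + indicator (i2 t) \<omega>) + ?B"
    proof eventually_elim
      case (elim \<omega>)
      then have "(\<Sum>t<n. err t \<omega>) \<le> (\<Sum>t<n. indicator (i1 t) \<omega> + indicator (i2 t) \<omega> + ?b t \<omega>)"
        by (intro sum_mono) auto
      also have "\<dots> = (\<Sum>t<n. indicator (i1 t) \<omega> + indicator (i2 t) \<omega>) + (\<Sum>t<n. ?b t \<omega>)"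
        by (rule sum.distrib)
      finally show ?case
        unfolding sum_bonus using sum_bonus_le[OF m c(1) K(1), of n \<omega>] by linarith
    qed
  qed (use i_sets in \<open>auto intro!: integrable_err Bochner_Integration.integrable_sum
      Bochner_Integration.integrable_add simp: emeasure_eq_measure\<close>)
  also have "\<dots> = (\<Sum>t<n. prob (i1 t) + prob (i2 t)) + ?B"
    using i_sets by (simp add: emeasure_eq_measure prob_space)
  also have "\<dots> \<le> (\<Sum>t<n. 2 / real m) + ?B"
    using i by (intro add_right_mono sum_mono) (smt (verit) add_divide_distrib)
  finally show ?thesis by simp
qed

end

section \<open>The regret bound\<close>

lemma ln_ge_2:
  fixes x :: real
  assumes "x \<ge> 9"
  shows "ln x \<ge> 2"
proof -
  have "exp 2 = exp 1 * exp (1 :: real)"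
    by (simp flip: exp_add)
  also have "\<dots> \<le> 3 * 3"
    by (intro mult_mono exp_le) auto
  finally show ?thesis
    using assms by (subst ln_ge_iff) auto
qed

text \<open>The constants of the theorem leave room: for \<open>m \<le> 18\<close> the linear term, and for \<open>T \<le> 6 K\<close> the
  square-root term, already exceeds the trivial bound \<open>\<tau> T\<close>. Otherwise rounding \<open>T\<close> up to whole episodes
  costs at most a factor \<open>7 / 6\<close>, and \<open>ln m \<ge> 2\<close> absorbs the remaining constants.\<close>

lemma regret_arith:
  fixes K T X R \<tau> mr :: real
  assumes m: "mr \<ge> 2" "mr \<le> 18 \<or> mr \<ge> 19" and tau: "\<tau> \<ge> 2" and K: "K \<ge> \<tau>" and T: "T \<ge> 0"
    and triv: "R \<le> \<tau> * T"
    and X: "0 \<le> X" "X \<le> T + \<tau>"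
    and main: "mr \<ge> 19 \<Longrightarrow> R \<le> 9 / 16 * \<tau>\<^sup>2 * (X * (2 / mr) +
       (K + 2 * sqrt (6 * ln (2 * K * mr)) * sqrt (K * X) + X * sqrt (6 * ln (2 * K * mr) / mr)))"
  shows "R \<le> \<tau>\<^sup>2 * sqrt (6 * K * T * ln mr * ln (2 * K * mr))
     + (3 / mr + sqrt (6 * max 3 (ln mr) / mr * ln (2 * K * mr))) * \<tau>\<^sup>2 * T"
proof -
  define L where "L = ln (2 * K * mr)"
  define sq where "sq = sqrt (6 * K * T * ln mr * L)"
  define lin where "lin = sqrt (6 * max 3 (ln mr) / mr * L)"
  have "2 * 2 * 2 \<le> 2 * K * mr"
    using m K tau by (intro mult_mono) auto
  moreover have "exp 1 \<le> (3 :: real)" by (rule exp_le)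
  ultimately have L: "L \<ge> 1"
    unfolding L_def by (subst ln_ge_iff) auto
  have lnm: "0 \<le> ln mr" using m by simp
  have nonneg: "0 \<le> sq" "0 \<le> lin" "0 \<le> 3 / mr"
    using m K tau T L lnm by (auto simp: sq_def lin_def)
  have tauT: "\<tau> * T \<le> \<tau>\<^sup>2 * T"
    using tau T by (intro mult_right_mono) (auto simp: power2_eq_square)
  have "R \<le> \<tau>\<^sup>2 * (sq + (3 / mr + lin) * T)"
  proof (cases "mr \<le> 18")
    case True
    \<comment> \<open>The 3 inside the maximum and the factor 6 give the threshold 18, below which
      the coefficient \<open>lin\<close> is at least 1.\<close>
    have "max 3 (ln mr) * L \<ge> 3 * 1"
      using L by (intro mult_mono) auto
    then have "18 \<le> 6 * max 3 (ln mr) * L"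
      unfolding mult.assoc by linarith
    then have "mr \<le> 6 * max 3 (ln mr) * L" using True by linarith
    then have "1 \<le> 6 * max 3 (ln mr) * L / mr" using m by (simp add: le_divide_eq)
    then have "1 \<le> lin" unfolding lin_def by simp
    then have "1 \<le> 3 / mr + lin" using nonneg(3) by linarith
    then have "1 * T \<le> (3 / mr + lin) * T"
      using T by (rule mult_right_mono)
    then have "T \<le> sq + (3 / mr + lin) * T" using nonneg by simp
    then have "\<tau>\<^sup>2 * T \<le> \<tau>\<^sup>2 * (sq + (3 / mr + lin) * T)"
      by (intro mult_left_mono) auto
    then show ?thesis using triv tauT by linarith
  next
    case False
    then have mr: "mr \<ge> 19" using m by auto
    then have lnm2: "ln mr \<ge> 2" by (intro ln_ge_2) auto
    have "2 * 1 \<le> ln mr * L" using lnm2 L by (intro mult_mono) auto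
    show ?thesis
    proof (cases "T \<le> 6 * K")
      case True
      have "T \<le> sq"
        unfolding sq_def
      proof (rule real_le_rsqrt)
        have "T * T \<le> T * (6 * K)" using True T by (intro mult_left_mono)
        also have "\<dots> = 6 * K * T * 1" by simp
        also have "\<dots> \<le> 6 * K * T * (ln mr * L)"
          using \<open>2 * 1 \<le> ln mr * L\<close> K tau T by (intro mult_left_mono) auto
        finally show "T\<^sup>2 \<le> 6 * K * T * ln mr * L"
          by (simp add: power2_eq_square mult.assoc)
      qed
      moreover have "0 \<le> (3 / mr + lin) * T" using nonneg T by simp
      ultimately have "\<tau>\<^sup>2 * T \<le> \<tau>\<^sup>2 * (sq + (3 / mr + lin) * T)"
        by (intro mult_left_mono) auto
      then show ?thesis using triv tauT by linarith
    next
      case False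
      \<comment> \<open>Here \<open>\<tau> \<le> K < T / 6\<close>, so the extra episode adds at
        most a sixth of \<open>T\<close>.\<close>
      then have X': "X \<le> 7 / 6 * T" using X K by linarith
      have Kpos: "K > 0" using K tau by linarith
      \<comment> \<open>The square-root term without its factor \<open>sqrt (ln mr)\<close>: the
        common scale for comparing first visits, the sum of the radii and \<open>sq\<close>.\<close>
      define q where "q = sqrt (6 * L) * sqrt (K * T)"
      have q: "0 \<le> q" using L Kpos T by (simp add: q_def)
      have "9 / 16 * (X * (2 / mr)) \<le> 9 / 16 * (7 / 6 * T * (2 / mr))"
        using X' mr by (intro mult_left_mono mult_right_mono) auto
      also have "\<dots> = 21 / 16 * (T / mr)" by simp
      also have "\<dots> \<le> 3 * (T / mr)"
        using T mr by (intro mult_right_mono) auto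
      finally have t1: "9 / 16 * (X * (2 / mr)) \<le> 3 / mr * T" by simp
      have "sqrt (6 * L / mr) \<le> lin"
        unfolding lin_def
      proof (rule real_sqrt_le_mono)
        have "6 * L / mr * 1 \<le> 6 * L / mr * max 3 (ln mr)"
          using L mr by (intro mult_left_mono) auto
        then show "6 * L / mr \<le> 6 * max 3 (ln mr) / mr * L" by (simp add: mult.commute)
      qed
      then have "X * sqrt (6 * L / mr) \<le> 7 / 6 * T * lin"
        using X X' L mr T by (intro mult_mono) auto
      also have "\<dots> = 7 / 6 * (lin * T)" by simp
      finally have "X * sqrt (6 * L / mr) \<le> 7 / 6 * (lin * T)" .
      moreover have "0 \<le> lin * T" using T nonneg by simp
      ultimately have t3: "9 / 16 * (X * sqrt (6 * L / mr)) \<le> lin * T"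
        by linarith
      \<comment> \<open>A rational square root: 7/6 is below (11/10)^2 = 1.21.\<close>
      have "sqrt (K * X) \<le> sqrt ((11 / 10)\<^sup>2 * (K * T))"
      proof (rule real_sqrt_le_mono)
        have "K * X \<le> K * (7 / 6 * T)" using X' Kpos by (intro mult_left_mono) auto
        also have "\<dots> = 7 / 6 * (K * T)" by simp
        also have "\<dots> \<le> (11 / 10)\<^sup>2 * (K * T)"
          using Kpos T by (intro mult_right_mono) (auto simp: power2_eq_square)
        finally show "K * X \<le> (11 / 10)\<^sup>2 * (K * T)" .
      qed
      then have "sqrt (K * X) \<le> 11 / 10 * sqrt (K * T)" by (simp add: real_sqrt_mult)
      then have "sqrt (6 * L) * sqrt (K * X) \<le> sqrt (6 * L) * (11 / 10 * sqrt (K * T))"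
        using L by (intro mult_left_mono) auto
      then have sx: "sqrt (6 * L) * sqrt (K * X) \<le> 11 / 10 * q" by (simp add: q_def)
      have "6 * K \<le> q"
        unfolding q_def real_sqrt_mult[symmetric]
      proof (rule real_le_rsqrt)
        have "6 * K * (6 * K) \<le> 6 * K * T" using False Kpos by (intro mult_left_mono) auto
        also have "\<dots> = 6 * K * T * 1" by simp
        also have "\<dots> \<le> 6 * K * T * L" using L Kpos T by (intro mult_left_mono) auto
        finally show "(6 * K)\<^sup>2 \<le> 6 * L * (K * T)"
          by (simp add: power2_eq_square mult_ac)
      qed
      \<comment> \<open>Since \<open>sq\<close> is \<open>q * sqrt (ln mr)\<close> and 49/25 is
        below 2, the bound \<open>ln mr \<ge> 2\<close> gains the factor 7/5.\<close>
      have "(7 / 5 * q)\<^sup>2 = 49 / 25 * (6 * L * (K * T))"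
        using L Kpos T by (simp add: q_def power_mult_distrib power_divide)
      also have "\<dots> \<le> ln mr * (6 * L * (K * T))"
        using L Kpos T lnm2 by (intro mult_right_mono) auto
      finally have "7 / 5 * q \<le> sq"
        unfolding sq_def by (intro real_le_rsqrt) (simp add: mult_ac)
      then have t2: "9 / 16 * (K + 2 * (sqrt (6 * L) * sqrt (K * X))) \<le> sq"
      proof -
        \<comment> \<open>The margin is numerical: 9/16 * (1/6 + 2 * 11/10) is about 1.331, below
          7/5.\<close>
        have "9 / 16 * (k + 2 * y) \<le> s" if "7 / 5 * q \<le> s" "y \<le> 11 / 10 * q" "6 * k \<le> q" for k y s :: real
          using that q by argo
        then show ?thesis using \<open>7 / 5 * q \<le> sq\<close> sx \<open>6 * K \<le> q\<close> .
      qed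
      have "9 / 16 * (X * (2 / mr) + (K + 2 * sqrt (6 * L) * sqrt (K * X) + X * sqrt (6 * L / mr)))
          \<le> sq + (3 / mr + lin) * T"
        using t1 t2 t3 by (simp only: distrib_right distrib_left mult.assoc)
      then have "\<tau>\<^sup>2 * (9 / 16 * (X * (2 / mr) + (K + 2 * sqrt (6 * L) * sqrt (K * X) + X * sqrt (6 * L / mr))))
          \<le> \<tau>\<^sup>2 * (sq + (3 / mr + lin) * T)"
        by (intro mult_left_mono) auto
      moreover have "9 / 16 * \<tau>\<^sup>2 * y = \<tau>\<^sup>2 * (9 / 16 * y)" for y by simp
      note main[OF mr, folded L_def, unfolded this]
      ultimately show ?thesis by (rule order_trans[rotated])
    qed
  qed
  then show ?thesis
    by (simp add: sq_def lin_def L_def algebra_simps)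
qed

context thompson_mdp
begin

lemma regret_bound:
  fixes T m :: nat
  assumes m: "m \<ge> 2"
  defines "K \<equiv> real (M * \<tau>) * real CARD('a)"
  shows "(\<Sum>t<T. regret t) \<le> (real \<tau>)\<^sup>2 * sqrt (6 * K * real T * ln (real m) * ln (2 * K * real m))
     + (3 / real m + sqrt (6 * max 3 (ln (real m)) / real m * ln (2 * K * real m))) * (real \<tau>)\<^sup>2 * real T"
proof (rule regret_arith)
  \<comment> \<open>Enough whole episodes to cover the horizon; the regret of the added times is
    nonnegative, and at most \<open>\<tau>\<close> times are added.\<close>
  define n where "n = T div \<tau> + 1"
  have "1 * real \<tau> * 1 \<le> real M * real \<tau> * real CARD('a)"
    using M by (intro mult_mono) (auto simp: Suc_le_eq)
  then show K_tau: "real \<tau> \<le> K" by (simp add: K_def)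
  have "(\<Sum>t<T. regret t) \<le> (\<Sum>t<T. real \<tau>)"
    by (intro sum_mono regret_le)
  then show "(\<Sum>t<T. regret t) \<le> real \<tau> * real T" by (simp add: mult.commute)
  have "T < n * \<tau>"
    using tau dividend_less_times_div[of \<tau> T] by (simp add: n_def algebra_simps)
  have "n * \<tau> \<le> T + \<tau>"
    using div_times_less_eq_dividend[of T \<tau>] by (simp add: n_def algebra_simps)
  then show "real (n * \<tau>) \<le> real T + real \<tau>"
    by (simp only: of_nat_add[symmetric] of_nat_le_iff)
  assume m19: "real m \<ge> 19"
  then have "ln (real m) \<ge> 2" by (intro ln_ge_2) auto
  then have lnm: "ln (real m) \<ge> 1" by linarith
  have K: "real (card informative) \<le> K" "K \<ge> 1"
    using card_informative_le K_tau tau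
    by (auto simp: K_def simp flip: of_nat_mult)
  have "(\<Sum>t<T. regret t) \<le> (\<Sum>t<n * \<tau>. regret t)"
    using \<open>T < n * \<tau>\<close> by (intro sum_mono2) (auto simp: regret_nonneg)
  also have "\<dots> \<le> 9 / 16 * (real \<tau>)\<^sup>2 * (\<Sum>t<n * \<tau>. expectation (err t))"
    by (rule regret_sum_le)
  also have "\<dots> \<le> 9 / 16 * (real \<tau>)\<^sup>2 * (real (n * \<tau>) * (2 / real m) +
      (K + 2 * sqrt (6 * ln (2 * K * real m)) * sqrt (K * real (n * \<tau>))
       + real (n * \<tau>) * sqrt (6 * ln (2 * K * real m) / real m)))"
    by (intro mult_left_mono sum_err_le m lnm K) auto
  finally show "(\<Sum>t<T. regret t) \<le> 9 / 16 * (real \<tau>)\<^sup>2 * (real (n * \<tau>) * (2 / real m) +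
      (K + 2 * sqrt (6 * ln (2 * K * real m)) * sqrt (K * real (n * \<tau>))
       + real (n * \<tau>) * sqrt (6 * ln (2 * K * real m) / real m)))" .
qed (use m tau in auto)

end

theorem theorem11:
  fixes M \<tau> :: nat and s0 :: "nat \<times> nat"
    and r :: "nat \<times> nat \<Rightarrow> 'a::finite \<Rightarrow> nat \<times> nat \<Rightarrow> real"
    and Pr :: "'w measure"
    and rho :: "'w \<Rightarrow> (nat \<times> nat) \<times> 'a \<Rightarrow> real"
    and S :: "nat \<Rightarrow> 'w \<Rightarrow> nat \<times> nat"
    and Act :: "nat \<Rightarrow> 'w \<Rightarrow> 'a"
    and rhohat :: "nat \<Rightarrow> 'w \<Rightarrow> (nat \<times> nat) \<times> 'a \<Rightarrow> real"
    and post :: "nat \<Rightarrow> 'w \<Rightarrow> ((nat \<times> nat) \<times> 'a \<Rightarrow> real) measure"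
    and T m :: nat
  assumes M: "M \<ge> 1" and tau: "\<tau> \<ge> 2"
    and s0: "fst s0 < M" "snd s0 = 0"
    and r: "\<And>s a s'. 0 \<le> r s a s' \<and> r s a s' \<le> 1"
    and prob: "prob_space Pr"
    \<comment> \<open>random variables\<close>
    and meas_rho: "rho \<in> measurable Pr (Theta M \<tau>)"
    and meas_S: "\<And>t. S t \<in> measurable Pr (count_space UNIV)"
    and meas_A: "\<And>t. Act t \<in> measurable Pr (count_space UNIV)"
    and meas_rhohat: "\<And>l. rhohat l \<in> measurable Pr (Theta M \<tau>)"
    \<comment> \<open>prior: independent uniform parameters\<close>
    and prior: "distr Pr (Theta M \<tau>) rho
                  = PiM (paramidx M \<tau>) (\<lambda>_. uniform_measure lborel {0..1::real})"
    \<comment> \<open>initial state\<close>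
    and init: "AE \<omega> in Pr. S 0 \<omega> = s0"
    \<comment> \<open>environment dynamics given everything up to the action A_t\<close>
    and dyn: "\<And>t s'. AE \<omega> in Pr.
        real_cond_exp Pr (FullAlg Pr M \<tau> rho (\<lambda>\<omega>. (histS S t \<omega>, histA Act (Suc t) \<omega>)) rhohat (Suc (t div \<tau>)))
                 (\<lambda>\<omega>. indicator {s'} (S (Suc t) \<omega>)) \<omega>
        = transP M \<tau> s0 (rho \<omega>) (S t \<omega>) (Act t \<omega>) s'"
    \<comment> \<open>post t is the posterior P_t = P(rho \<in> . | H_t), a regular conditional distribution\<close>
    and post_meas: "\<And>t. post t \<in> measurable (HistAlg Pr S Act t) (prob_algebra (Theta M \<tau>))"
    and post_cond: "\<And>t B. B \<in> sets (Theta M \<tau>) \<Longrightarrow> AE \<omega> in Pr.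
        real_cond_exp Pr (HistAlg Pr S Act t) (\<lambda>\<omega>. indicator B (rho \<omega>)) \<omega> = measure (post t \<omega>) B"
    \<comment> \<open>Thompson sampling: rhohat_l is drawn from P_{l tau}, independently of everything else\<close>
    and sampling: "\<And>l B. B \<in> sets (Theta M \<tau>) \<Longrightarrow> AE \<omega> in Pr.
        real_cond_exp Pr (FullAlg Pr M \<tau> rho (hist S Act (l * \<tau>)) rhohat l)
                 (\<lambda>\<omega>. indicator B (rhohat l \<omega>)) \<omega> = measure (post (l * \<tau>) \<omega>) B"
    \<comment> \<open>actions are greedy with respect to the sampled Q-function\<close>
    and greedy: "\<And>t. AE \<omega> in Pr.
        Qfun M \<tau> s0 r (rhohat (t div \<tau>) \<omega>) (S t \<omega>) (Act t \<omega>)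
        = Vfun M \<tau> s0 r (rhohat (t div \<tau>) \<omega>) (S t \<omega>)"
    \<comment> \<open>tie-breaking is done by the agent: it uses only the agent's information\<close>
    and agent_policy: "\<And>t a. AE \<omega> in Pr.
        real_cond_exp Pr (FullAlg Pr M \<tau> rho (hist S Act t) rhohat (Suc (t div \<tau>)))
                 (\<lambda>\<omega>. indicator {a} (Act t \<omega>)) \<omega>
        = real_cond_exp Pr (AgentAlg Pr M \<tau> (hist S Act t) rhohat (Suc (t div \<tau>)))
                 (\<lambda>\<omega>. indicator {a} (Act t \<omega>)) \<omega>"
    \<comment> \<open>optimism hypothesis, conditioning on the sigma-algebra generated by P_{l tau}\<close>
    and optimism: "\<And>l t. l * \<tau> \<le> t \<Longrightarrow> t < (Suc l) * \<tau> \<Longrightarrow> AE \<omega> in Pr.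
        real_cond_exp Pr (vimage_algebra (space Pr) (post (l * \<tau>)) (prob_algebra (Theta M \<tau>)))
                 (\<lambda>\<omega>. Vfun M \<tau> s0 r (rho \<omega>) (S t \<omega>)) \<omega>
        \<le> real_cond_exp Pr (vimage_algebra (space Pr) (post (l * \<tau>)) (prob_algebra (Theta M \<tau>)))
                 (\<lambda>\<omega>. Vfun M \<tau> s0 r (rhohat l \<omega>) (S t \<omega>)) \<omega>"
    and m: "m \<ge> 2"
  shows "(\<integral>\<omega>. (\<Sum>t<T. Vfun M \<tau> s0 r (rho \<omega>) (S t \<omega>)
                      - Qfun M \<tau> s0 r (rho \<omega>) (S t \<omega>) (Act t \<omega>)) \<partial>Pr)
    \<le> (let \<delta> = 1 / real m; nS = real (M * \<tau>); nA = real CARD('a) in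
         real \<tau> ^ 2 * sqrt (6 * nS * nA * real T * ln (1 / \<delta>) * ln (2 * nS * nA / \<delta>))
       + (3 * \<delta> + sqrt (6 * max 3 (ln (1 / \<delta>)) * \<delta> * ln (2 * nS * nA / \<delta>)))
           * real \<tau> ^ 2 * real T)"
proof -
  interpret thompson_mdp Pr M \<tau> s0 r rho S Act rhohat post
    by (intro thompson_mdp.intro thompson_mdp_axioms.intro; fact)
  have "(\<integral>\<omega>. (\<Sum>t<T. Vfun M \<tau> s0 r (rho \<omega>) (S t \<omega>) - Qfun M \<tau> s0 r (rho \<omega>) (S t \<omega>) (Act t \<omega>)) \<partial>Pr)
      = (\<Sum>t<T. regret t)"
    unfolding regret_def
    by (intro Bochner_Integration.integral_sum Bochner_Integration.integrable_diff integrable_rho)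
  also note regret_bound[OF m, of T]
  finally show ?thesis
    by (simp add: Let_def mult_ac)
qed

end
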